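(* Let $N\ge 1$ be an integer. For every real number $s>0$ and every analytic set $E\subseteq\mathbf{R}^N$, $$\mathrm{P}\text{-}\dim_s E=\mathrm{Dim}_s E,$$ where $\mathrm{P}\text{-}\dim_s$ is Howroyd's $s$-dimensional packing dimension profile and $\mathrm{Dim}_s$ is the Falconer--Howroyd $s$-dimensional packing dimension profile.
   Context: $|\cdot|$ denotes the Euclidean norm. For $s\in(0,\infty)$ let $\psi_s(x):=\min(1,|x|^{-s})$ for $x\in\mathbf{R}^N$ (so $\psi_s(0)=1$). **Falconer--Howroyd profile $\mathrm{Dim}_s$.** For a finite Borel measure $\mu$ on $\mathbf{R}^N$ and $r>0$ set $$F_s^\mu(x,r):=\int_{\mathbf{R}^N}\psi_s\!\left(\frac{x-y}{r}\right)\mu(dy),$$ $$\mathrm{Dim}_s\,\mu:=\sup\Big\{t\ge 0:\ \liminf_{r\downarrow 0}\frac{F_s^\mu(x,r)}{r^t}=0\ \text{ for } \mu\text{-almost all }x\in\mathbf{R}^N\Big\}.$$ For $E\subseteq\mathbf{R}^N$ let $\mathscr{M}_c^+(E)$ be the collection of all nonzero finite Borel measures on $\mathbf{R}^N$ with compact support contained in $E$, and set $$\mathrm{Dim}_s E:=\sup\{\mathrm{Dim}_s\,\mu:\ \mu\in\mathscr{M}_c^+(E)\}.$$ In both definitions $\sup\varnothing:=0$. **Howroyd profile $\mathrm{P}\text{-}\dim_s$.** For $E\subseteq\mathbf{R}^N$, $s>0$, $\delta>0$, a sequence of triples $(w_i,x_i,r_i)_{i=1}^\infty$ is a $(\psi_s,\delta)$-packing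 of $E$ if $w_i\ge 0$, $x_i\in E$, $0<r_i\le\delta$ for all $i$, and $$\sup_{i\ge 1}\sum_{j=1}^\infty w_j\,\psi_s\!\left(\frac{x_i-x_j}{r_j}\right)\le 1.$$ For $\alpha>0$ define $$\mathcal{P}_0^{\alpha,s}(E):=\lim_{\delta\downarrow 0}\sup\Big\{\sum_{i=1}^\infty w_i(2r_i)^\alpha:\ (w_i,x_i,r_i)_{i=1}^\infty\text{ is a }(\psi_s,\delta)\text{-packing of }E\Big\}$$ (with $\sup\varnothing:=0$), $$\mathcal{P}^{\alpha,s}(E):=\inf\Big\{\sum_{k=1}^\infty\mathcal{P}_0^{\alpha,s}(E_k):\ E\subseteq\bigcup_{k=1}^\infty E_k\Big\},$$ $$\mathrm{P}\text{-}\dim_s E:=\inf\{\alpha>0:\ \mathcal{P}^{\alpha,s}(E)=0\}.$$ *)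

theory Defs
  imports "HOL-Analysis.Analysis"
begin

text \<open>
  All dimensions are values in \<^typ>\<open>ennreal\<close>, where the supremum of the empty set is \<open>0\<close>
  and the infimum of the empty set is \<open>\<infinity>\<close>. Sequences are indexed from \<open>0\<close>.
\<close>

text \<open>The separate case is needed since \<open>0 powr (- s) = 0\<close> in HOL.\<close>

definition psi :: "real \<Rightarrow> 'a::euclidean_space \<Rightarrow> real" where
  "psi s x = (if x = 0 then 1 else min 1 (norm x powr (- s)))"

text \<open>
  A set is analytic if it is empty or a continuous image of the Baire space: here \<^typ>\<open>nat\<close> is
  discrete and \<^typ>\<open>nat \<Rightarrow> nat\<close> carries the product topology.
\<close>

definition analytic_set :: "'a::topological_space set \<Rightarrow> bool" where
  "analytic_set E \<longleftrightarrow> E = {} \<or> (\<exists>f :: (nat \<Rightarrow> nat) \<Rightarrow> 'a. continuous_on UNIV f \<and> E = range f)"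


subsection \<open>The Falconer--Howroyd profile\<close>

definition finite_borel_measure :: "'a::topological_space measure \<Rightarrow> bool" where
  "finite_borel_measure \<mu> \<longleftrightarrow> finite_measure \<mu> \<and> sets \<mu> = sets borel"

definition measure_support :: "'a::topological_space measure \<Rightarrow> 'a set" where
  "measure_support \<mu> = {x. \<forall>U. open U \<and> x \<in> U \<longrightarrow> emeasure \<mu> U > 0}"

definition FH_kernel :: "real \<Rightarrow> 'a::euclidean_space measure \<Rightarrow> 'a \<Rightarrow> real \<Rightarrow> real" where
  "FH_kernel s \<mu> x r = (\<integral>y. psi s ((x - y) /\<^sub>R r) \<partial>\<mu>)"

definition Dim_measure :: "real \<Rightarrow> 'a::euclidean_space measure \<Rightarrow> ennreal" where
  "Dim_measure s \<mu> =
     (SUP t\<in>{t. 0 \<le> t \<and>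
        (AE x in \<mu>. Liminf (at_right 0) (\<lambda>r. ennreal (FH_kernel s \<mu> x r / r powr t)) = 0)}.
      ennreal t)"

definition Mc_plus :: "'a::euclidean_space set \<Rightarrow> 'a measure set" where
  "Mc_plus E = {\<mu>. finite_borel_measure \<mu> \<and> emeasure \<mu> (space \<mu>) \<noteq> 0 \<and>
                   compact (measure_support \<mu>) \<and> measure_support \<mu> \<subseteq> E}"

definition Dim :: "real \<Rightarrow> 'a::euclidean_space set \<Rightarrow> ennreal" where
  "Dim s E = (SUP \<mu>\<in>Mc_plus E. Dim_measure s \<mu>)"


subsection \<open>The Howroyd profile\<close>

definition psi_packing ::
    "real \<Rightarrow> real \<Rightarrow> 'a::euclidean_space set \<Rightarrow> (nat \<Rightarrow> real \<times> 'a \<times> real) \<Rightarrow> bool" where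
  "psi_packing s \<delta> E T \<longleftrightarrow>
     (\<forall>i. case T i of (w, x, r) \<Rightarrow> 0 \<le> w \<and> x \<in> E \<and> 0 < r \<and> r \<le> \<delta>) \<and>
     (SUP i. \<Sum>j. case (T i, T j) of ((_, x\<^sub>i, _), (w\<^sub>j, x\<^sub>j, r\<^sub>j)) \<Rightarrow>
        ennreal (w\<^sub>j * psi s ((x\<^sub>i - x\<^sub>j) /\<^sub>R r\<^sub>j))) \<le> 1"

definition packing_sup :: "real \<Rightarrow> real \<Rightarrow> 'a::euclidean_space set \<Rightarrow> real \<Rightarrow> ennreal" where
  "packing_sup \<alpha> s E \<delta> =
     (SUP T\<in>{T. psi_packing s \<delta> E T}. \<Sum>i. case T i of (w, _, r) \<Rightarrow> ennreal (w * (2 * r) powr \<alpha>))"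

definition packing_premeasure :: "real \<Rightarrow> real \<Rightarrow> 'a::euclidean_space set \<Rightarrow> ennreal" where
  "packing_premeasure \<alpha> s E = Lim (at_right 0) (packing_sup \<alpha> s E)"

text \<open>The limit exists by monotonicity in \<open>\<delta>\<close>.\<close>

lemma packing_sup_mono: "\<delta> \<le> \<delta>' \<Longrightarrow> packing_sup \<alpha> s E \<delta> \<le> packing_sup \<alpha> s E \<delta>'"
  unfolding packing_sup_def
  by (rule SUP_subset_mono) (fastforce simp: psi_packing_def split: prod.splits)+

lemma tendsto_packing_sup:
  "(packing_sup \<alpha> s E \<longlongrightarrow> (INF \<delta>\<in>{0<..}. packing_sup \<alpha> s E \<delta>)) (at_right 0)"
proof (rule decreasing_tendsto)
  show "\<forall>\<^sub>F \<delta> in at_right 0. (INF \<delta>\<in>{0<..}. packing_sup \<alpha> s E \<delta>) \<le> packing_sup \<alpha> s E \<delta>"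
    by (auto simp: eventually_at_filter intro!: INF_lower always_eventually)
next
  fix y assume "(INF \<delta>\<in>{0<..}. packing_sup \<alpha> s E \<delta>) < y"
  then obtain d where d: "0 < d" "packing_sup \<alpha> s E d < y"
    by (auto simp: INF_less_iff)
  have "\<forall>\<^sub>F \<delta> in at_right (0::real). \<delta> < d"
    using d(1) by (auto simp: eventually_at_right)
  then show "\<forall>\<^sub>F \<delta> in at_right 0. packing_sup \<alpha> s E \<delta> < y"
    by eventually_elim (meson d(2) le_less_trans less_imp_le packing_sup_mono)
qed

lemma packing_premeasure_eq_INF:
  "packing_premeasure \<alpha> s E = (INF \<delta>\<in>{0<..}. packing_sup \<alpha> s E \<delta>)"
  unfolding packing_premeasure_def by (intro tendsto_Lim tendsto_packing_sup) simp

definition packing_measure :: "real \<Rightarrow> real \<Rightarrow> 'a::euclidean_space set \<Rightarrow> ennreal" where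
  "packing_measure \<alpha> s E =
     (INF Es\<in>{Es :: nat \<Rightarrow> 'a set. E \<subseteq> (\<Union>k. Es k)}. \<Sum>k. packing_premeasure \<alpha> s (Es k))"

definition P_dim :: "real \<Rightarrow> 'a::euclidean_space set \<Rightarrow> ennreal" where
  "P_dim s E = (INF \<alpha>\<in>{\<alpha>. 0 < \<alpha> \<and> packing_measure \<alpha> s E = 0}. ennreal \<alpha>)"

end

theory Submission
  imports Defs
begin

text \<open>
  If \<open>liminf F(x,r) / r\<^sup>t = 0\<close> on a set \<open>A\<close>, then a single dyadic scale \<open>r\<close> suffices at a time: choose
  points \<open>x\<^sub>j\<close> with \<open>F(x\<^sub>j,r) \<le> r\<^sup>t\<close> in cells of diameter at most \<open>r\<close>. The weights
  \<open>2\<^sup>-\<^sup>s r\<^sup>-\<^sup>t \<mu>(cell)\<close> form a packing. Were the premeasure of \<open>A\<close> of order \<open>\<alpha> < t\<close> finite, the cells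
  used at scale \<open>r\<close> would have total mass \<open>O(r\<^sup>t\<^sup>-\<^sup>\<alpha>)\<close>, so \<open>A\<close> would be null by Borel--Cantelli. Hence
  \<open>Dim\<^sub>s E \<le> P-dim\<^sub>s E\<close>, for arbitrary \<open>E\<close>.

  Conversely, let \<open>\<beta> < \<alpha>\<close> and let \<open>E\<close> have positive packing measure of order \<open>\<alpha>\<close>. Pigeonholing the radii of a packing
  dyadically gives, at arbitrarily small scales \<open>r\<close>, a finitely supported probability measure \<open>\<nu>\<close>
  with \<open>F\<^sup>\<nu>(x,r) \<le> r\<^sup>\<beta>\<close> on its support. Write \<open>E\<close> as a continuous image of the Baire space and
  discard all cylinders with negligible image; then every remaining cylinder carries such measures.
  Replace each atom repeatedly by a measure of this kind living in a small cylinder around it. Atoms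
  at positive distance interact only by \<open>O(r\<^sup>s)\<close>, which is dominated by \<open>r\<^sup>\<beta>\<close> since \<open>\<beta> < s\<close>. The limit is
  realised as the law of a random variable on the unit interval, so that no weak compactness is needed,
  and its support lies in the image of a compact product of finite sets.
\<close>

subsection \<open>The kernel\<close>

text \<open>This single formula absorbs both the value at the origin and the truncation at 1, so
  that monotonicity and continuity become properties of \<open>powr\<close>.\<close>

lemma psi_eq:
  assumes "s \<ge> 0" shows "psi s x = max 1 (norm x) powr (- s)"
proof (cases "norm x \<ge> 1")
  case True
  then have "norm x powr (- s) \<le> 1" using assms by (simp add: powr_minus ge_one_powr_ge_zero inverse_le_1_iff)
  then show ?thesis using True by (auto simp: psi_def max_def min_def)
next
  case False
  then have "x \<noteq> 0 \<Longrightarrow> norm x powr (- s) \<ge> 1"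
    using assms powr_mono2'[of "- s" "norm x" 1] by simp
  then show ?thesis using False by (auto simp: psi_def max_def min_def)
qed

lemma psi_le_1: "psi s x \<le> 1"
  by (simp add: psi_def)

lemma psi_nonneg: "0 \<le> psi s x"
  by (simp add: psi_def)

lemma psi_antimono:
  assumes "s \<ge> 0" "norm x \<le> norm y" shows "psi s y \<le> psi s x"
  using assms by (auto simp: psi_eq intro!: powr_mono2')

lemma psi_divideR_mono:
  assumes "s \<ge> 0" "0 < r" "r \<le> r'" shows "psi s (x /\<^sub>R r) \<le> psi s (x /\<^sub>R r')"
  using assms by (intro psi_antimono) (auto intro!: mult_right_mono)

text \<open>Since \<open>norm y \<le> norm x + 1\<close>, the truncated norm
  \<open>max 1 (norm y)\<close> is at most twice \<open>max 1 (norm x)\<close>. This is what allows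
  centres to be moved by up to one radius, both for cells and for later stages of the tree.\<close>

lemma psi_perturb:
  assumes "s \<ge> 0" "norm (x - y) \<le> 1" shows "psi s x \<le> 2 powr s * psi s y"
proof -
  have "norm y \<le> norm x + 1"
    using norm_triangle_ineq2[of y x] assms(2) by (simp add: norm_minus_commute)
  then have "max 1 (norm y) / 2 \<le> max 1 (norm x)" by (auto simp: max_def)
  then have "psi s x \<le> (max 1 (norm y) / 2) powr (- s)"
    using assms by (auto simp: psi_eq intro!: powr_mono2')
  also have "\<dots> = 2 powr s * psi s y"
    using assms by (simp add: psi_eq powr_divide powr_minus field_simps)
  finally show ?thesis .
qed

lemma psi_divideR_perturb:
  assumes "s \<ge> 0" "0 < r" "norm (x - y) \<le> r"
  shows "psi s (x /\<^sub>R r) \<le> 2 powr s * psi s (y /\<^sub>R r)"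
  using assms by (intro psi_perturb) (auto simp: divide_simps simp flip: scaleR_diff_right)

text \<open>Controls the interaction of atoms at distance at least \<open>d\<close>. The next lower
  bound but one is its counterpart for points at distance at most \<open>d\<close>.\<close>

lemma psi_divideR_le:
  assumes "s \<ge> 0" "0 < r" "0 < d" "d \<le> norm x"
  shows "psi s (x /\<^sub>R r) \<le> (r / d) powr s"
proof -
  have "psi s (x /\<^sub>R r) \<le> (d / r) powr (- s)"
    using assms by (auto simp: psi_eq divide_simps le_max_iff_disj intro!: powr_mono2')
  also have "\<dots> = (r / d) powr s"
    using assms by (simp add: powr_divide powr_minus field_simps)
  finally show ?thesis .
qed

lemma psi_divideR_ge:
  assumes "s \<ge> 0" "0 < r" "r \<le> d" "norm x \<le> d"
  shows "(r / d) powr s \<le> psi s (x /\<^sub>R r)"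
proof -
  have "(r / d) powr s = (d / r) powr (- s)"
    using assms by (simp add: powr_divide powr_minus field_simps)
  also have "\<dots> \<le> psi s (x /\<^sub>R r)"
    using assms unfolding psi_eq[OF assms(1)] by (intro powr_mono2') (auto simp: field_simps)
  finally show ?thesis .
qed

lemma continuous_psi: "s \<ge> 0 \<Longrightarrow> continuous_on A (psi s)"
  by (subst continuous_on_cong[OF refl psi_eq]) (auto intro!: continuous_intros)

lemma borel_measurable_psi:
  assumes "s \<ge> 0" "f \<in> borel_measurable M" shows "(\<lambda>x. psi s (f x)) \<in> borel_measurable M"
  using measurable_compose[OF assms(2) borel_measurable_continuous_onI[OF continuous_psi[OF assms(1)]]] .

lemma integrable_psi:
  assumes "s \<ge> 0" "finite_measure M" "f \<in> borel_measurable M"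
  shows "integrable M (\<lambda>x. psi s (f x))"
  using assms by (intro finite_measure.integrable_const_bound[where B=1] borel_measurable_psi)
    (auto simp: psi_le_1 psi_nonneg)

section \<open>Reduction to dyadic scales\<close>

lemma dyadic_between:
  assumes "0 < r" "r \<le> (1/2) ^ n"
  shows "\<exists>m\<ge>n. (1/2) ^ m \<le> r \<and> r \<le> 2 * (1/2::real) ^ m"
proof -
  define m where "m = (LEAST m. (1/2::real) ^ m \<le> r)"
  have "\<exists>m. (1/2::real) ^ m \<le> r"
    using real_arch_pow_inv[OF assms(1), of "1/2"] by (auto intro: less_imp_le)
  then have m: "(1/2) ^ m \<le> r" unfolding m_def by (rule LeastI_ex)
  show ?thesis
  proof (cases "n \<le> m")
    case True
    have "r \<le> 2 * (1/2::real) ^ m"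
    proof (cases "m = 0")
      case True then show ?thesis using assms power_le_one[of "1/2::real" n] by simp
    next
      case False
      then obtain k where k: "m = Suc k" using not0_implies_Suc by blast
      then have "\<not> (1/2::real) ^ k \<le> r" using not_less_Least[of k "\<lambda>m. (1/2::real) ^ m \<le> r"] by (simp flip: m_def)
      then show ?thesis by (simp add: k)
    qed
    with True m show ?thesis by blast
  next
    case False
    then have "(1/2::real) ^ n \<le> (1/2) ^ m" by (intro power_decreasing) auto
    with m assms have "r = (1/2)^n" by linarith
    then show ?thesis by (intro exI[of _ n]) simp
  qed
qed

lemma FH_kernel_mono:
  assumes "s \<ge> 0" "finite_borel_measure \<mu>" "0 < r" "r \<le> r'"
  shows "FH_kernel s \<mu> x r \<le> FH_kernel s \<mu> x r'"
proof -
  have [measurable_cong]: "sets \<mu> = sets borel" and fin: "finite_measure \<mu>"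
    using assms by (auto simp: finite_borel_measure_def)
  show ?thesis unfolding FH_kernel_def using assms fin
    by (intro integral_mono integrable_psi psi_divideR_mono) auto
qed

lemma FH_kernel_nonneg: "0 \<le> FH_kernel s \<mu> x r"
  by (simp add: FH_kernel_def psi_nonneg)

lemma Liminf_FH_kernel_0_dyadic:
  assumes "s \<ge> 0" "finite_borel_measure \<mu>" "t \<ge> 0"
    and "Liminf (at_right 0) (\<lambda>r. ennreal (FH_kernel s \<mu> x r / r powr t)) = 0"
  shows "\<exists>m\<ge>n. FH_kernel s \<mu> x ((1/2)^m) \<le> ((1/2)^m) powr t"
proof -
  \<comment> \<open>The threshold pays for rounding \<open>r\<close> down to a dyadic scale: the
    kernel only decreases, while \<open>r powr t\<close> may exceed the dyadic power by the factor
    \<open>2 powr t\<close>.\<close>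
  let ?P = "\<lambda>r. ennreal (2 powr (-t)) \<le> ennreal (FH_kernel s \<mu> x r / r powr t)"
  have "\<exists>\<^sub>F r in at_right 0. \<not> ?P r"
  proof (rule ccontr)
    assume "\<not> (\<exists>\<^sub>F r in at_right 0. \<not> ?P r)"
    then have "\<forall>\<^sub>F r in at_right 0. ?P r" by (simp add: not_frequently)
    from Liminf_bounded[OF this] show False using assms(4) by (simp add: ennreal_eq_0_iff)
  qed
  moreover have "\<forall>\<^sub>F r in at_right 0. 0 < r \<and> r < (1/2::real)^n"
    by (intro eventually_conj eventually_at_right_less order_tendstoD(2)[OF tendsto_ident_at]) simp
  ultimately have "\<exists>\<^sub>F r in at_right 0. \<not> ?P r \<and> 0 < r \<and> r < (1/2::real)^n"
    by (rule frequently_eventually_frequently)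
  then obtain r where r: "0 < r" "r < (1/2::real)^n"
    "\<not> ennreal (2 powr (-t)) \<le> ennreal (FH_kernel s \<mu> x r / r powr t)"
    by (auto dest: frequently_ex)
  obtain m where m: "m \<ge> n" "(1/2) ^ m \<le> r" "r \<le> 2 * (1/2::real) ^ m"
    using dyadic_between[of r n] r by auto
  have "FH_kernel s \<mu> x r / r powr t < 2 powr (-t)"
    using r(3) by (auto simp: not_le ennreal_less_iff FH_kernel_nonneg)
  then have "FH_kernel s \<mu> x r \<le> 2 powr (-t) * r powr t"
    using r by (simp add: divide_simps)
  also have "\<dots> \<le> 2 powr (-t) * (2 * (1/2::real) ^ m) powr t"
    using m r assms by (intro mult_left_mono powr_mono2) auto
  also have "\<dots> = ((1/2)^m) powr t"
    by (simp add: powr_mult powr_minus)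
  finally show ?thesis
    using FH_kernel_mono[OF assms(1,2), of "(1/2)^m" r x] m by force
qed

lemma packing_premeasure_mono:
  assumes "A \<subseteq> B" shows "packing_premeasure \<alpha> s A \<le> packing_premeasure \<alpha> s B"
  unfolding packing_premeasure_eq_INF packing_sup_def
proof (intro INF_mono' SUP_subset_mono)
  show "{T. psi_packing s \<delta> A T} \<subseteq> {T. psi_packing s \<delta> B T}" for \<delta>
    using assms by (fastforce simp: psi_packing_def split: prod.splits)
qed auto

subsection \<open>Measures with small potentials produce packings\<close>

text \<open>Balls of radius \<open>r / 2\<close> about a countable dense set cover the space; making
  them disjoint keeps their diameter at most \<open>r\<close>.\<close>

lemma countable_borel_partition:
  assumes "0 < r"
  shows "\<exists>C :: nat \<Rightarrow> 'a::euclidean_space set. disjoint_family C \<and> (\<Union>j. C j) = UNIV \<and>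
           (\<forall>j. C j \<in> sets borel) \<and> (\<forall>j. \<forall>x\<in>C j. \<forall>y\<in>C j. norm (x - y) \<le> r)"
proof -
  obtain D :: "'a set" where D: "countable D" "\<And>X. open X \<Longrightarrow> X \<noteq> {} \<Longrightarrow> \<exists>d\<in>D. d \<in> X"
    using countable_dense_setE by blast
  define B where "B = (\<lambda>j. ball (from_nat_into D j) (r / 2))"
  have "\<exists>j. x \<in> B j" for x
  proof -
    obtain d where "d \<in> D" "d \<in> ball x (r / 2)"
      using D(2)[of "ball x (r/2)"] assms by auto
    then show ?thesis
      using from_nat_into_surj[OF D(1)] by (metis B_def mem_ball dist_commute)
  qed
  then have "(\<Union>j. disjointed B j) = UNIV"
    by (auto simp: UN_disjointed_eq)
  moreover have "disjointed B j \<in> sets borel" for j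
    by (auto simp: disjointed_def B_def)
  moreover have "norm (x - y) \<le> r" if "x \<in> disjointed B j" "y \<in> disjointed B j" for x y j
  proof -
    have "x \<in> B j" "y \<in> B j" using that disjointed_subset[of B j] by auto
    then show ?thesis
      using dist_triangle_half_r[of "from_nat_into D j" x r y] by (simp add: B_def dist_norm)
  qed
  ultimately show ?thesis using disjoint_family_disjointed by blast
qed

lemma ennreal_FH_kernel:
  assumes "s \<ge> 0" "finite_borel_measure \<mu>"
  shows "ennreal (FH_kernel s \<mu> x r) = (\<integral>\<^sup>+y. ennreal (psi s ((x - y) /\<^sub>R r)) \<partial>\<mu>)"
proof -
  have [measurable_cong]: "sets \<mu> = sets borel" and fin: "finite_measure \<mu>"
    using assms by (auto simp: finite_borel_measure_def)
  show ?thesis unfolding FH_kernel_def using assms fin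
    by (intro nn_integral_eq_integral[symmetric] integrable_psi) (auto simp: psi_nonneg)
qed

text \<open>\<open>B\<close> may fail to be measurable, so its mass is replaced by that of
  \<open>U\<close>, the union of the cells that meet it. Moving a centre inside its cell costs the
  factor \<open>2 powr s\<close>, which the weights compensate; their potential at \<open>x\<close>
  is then at most \<open>r powr (-t) * FH_kernel s \<mu> x r \<le> 1\<close>.\<close>

lemma packing_sup_ge_single_scale:
  fixes B :: "'a::euclidean_space set"
  assumes s: "s \<ge> 0" and \<mu>: "finite_borel_measure \<mu>"
    and r: "0 < r" "r \<le> \<delta>" and t: "\<And>x. x \<in> B \<Longrightarrow> FH_kernel s \<mu> x r \<le> r powr t" and "B \<subseteq> A"
  shows "\<exists>U\<in>sets \<mu>. B \<subseteq> U \<and>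
    ennreal (2 powr (\<alpha> - s) * r powr (\<alpha> - t)) * emeasure \<mu> U \<le> packing_sup \<alpha> s A \<delta>"
proof (cases "B = {}")
  case True
  then show ?thesis by (intro bexI[of _ "{}"]) auto
next
  case False
  then obtain b where b: "b \<in> B" by blast
  have sets [measurable_cong]: "sets \<mu> = sets borel" and fin: "finite_measure \<mu>"
    using \<mu> by (auto simp: finite_borel_measure_def)
  interpret finite_measure \<mu> by fact
  obtain C :: "nat \<Rightarrow> 'a set" where C: "disjoint_family C" "(\<Union>j. C j) = UNIV"
    "\<And>j. C j \<in> sets borel" "\<And>j x y. x \<in> C j \<Longrightarrow> y \<in> C j \<Longrightarrow> norm (x - y) \<le> r"
    using countable_borel_partition[OF r(1)] by metis
  \<comment> \<open>Cells missing \<open>B\<close> get weight zero by taking \<open>V j\<close>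
    empty. Their centre defaults to \<open>b\<close>, because every centre of a packing must lie in
    the set.\<close>
  define V where "V j = (if C j \<inter> B = {} then {} else C j)" for j
  define x where "x j = (if C j \<inter> B = {} then b else (SOME y. y \<in> C j \<inter> B))" for j
  define w where "w j = measure \<mu> (V j) * (2 powr (- s) * r powr (- t))" for j
  have V: "disjoint_family V" "range V \<subseteq> sets \<mu>"
    using C by (auto simp: V_def sets disjoint_family_on_def)
  have x: "x j \<in> B" "C j \<inter> B \<noteq> {} \<Longrightarrow> x j \<in> C j" for j
    using b someI_ex[of "\<lambda>y. y \<in> C j \<inter> B"] by (auto simp: x_def)
  have w0: "w j \<ge> 0" for j by (simp add: w_def)
  have near: "norm (x j - y) \<le> r" if "y \<in> V j" for y j
    using that C(4)[of "x j" j y] x(2)[of j] by (auto simp: V_def split: if_splits)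
  have sum_le: "(\<Sum>j. ennreal (w j * psi s ((x i - x j) /\<^sub>R r))) \<le> 1" for i
  proof -
    have "(\<Sum>j. ennreal (w j * psi s ((x i - x j) /\<^sub>R r))) \<le>
        (\<Sum>j. ennreal (r powr (- t)) * (\<integral>\<^sup>+y\<in>V j. ennreal (psi s ((x i - y) /\<^sub>R r)) \<partial>\<mu>))"
    proof (intro suminf_le)
      fix j
      have "ennreal (w j * psi s ((x i - x j) /\<^sub>R r)) =
         ennreal (r powr (- t)) * (ennreal (2 powr (- s) * psi s ((x i - x j) /\<^sub>R r)) * emeasure \<mu> (V j))"
        by (simp add: w_def emeasure_eq_measure ennreal_mult[symmetric] psi_nonneg mult_ac)
      also have "ennreal (2 powr (- s) * psi s ((x i - x j) /\<^sub>R r)) * emeasure \<mu> (V j) =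
         (\<integral>\<^sup>+y\<in>V j. ennreal (2 powr (- s) * psi s ((x i - x j) /\<^sub>R r)) \<partial>\<mu>)"
        using V by (subst nn_integral_cmult_indicator) auto
      also have "\<dots> \<le> (\<integral>\<^sup>+y\<in>V j. ennreal (psi s ((x i - y) /\<^sub>R r)) \<partial>\<mu>)"
      proof (intro nn_integral_mono)
        fix y
        have "2 powr (- s) * psi s ((x i - x j) /\<^sub>R r) \<le> psi s ((x i - y) /\<^sub>R r)" if "y \<in> V j"
          using psi_divideR_perturb[OF s r(1), of "x i - x j" "x i - y"] near[OF that]
          by (simp add: powr_minus field_simps norm_minus_commute)
        then show "ennreal (2 powr (- s) * psi s ((x i - x j) /\<^sub>R r)) * indicator (V j) y \<le>
          ennreal (psi s ((x i - y) /\<^sub>R r)) * indicator (V j) y"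
          by (auto simp: indicator_def intro!: ennreal_leI)
      qed
      finally show "ennreal (w j * psi s ((x i - x j) /\<^sub>R r)) \<le>
        ennreal (r powr (- t)) * (\<integral>\<^sup>+y\<in>V j. ennreal (psi s ((x i - y) /\<^sub>R r)) \<partial>\<mu>)"
        by (simp add: mult_left_mono)
    qed auto
    also have "\<dots> = ennreal (r powr (- t)) * (\<integral>\<^sup>+y\<in>(\<Union>j. V j). ennreal (psi s ((x i - y) /\<^sub>R r)) \<partial>\<mu>)"
      using V s by (subst nn_integral_disjoint_family) (auto intro!: measurable_compose[OF borel_measurable_psi measurable_ennreal])
    also have "(\<integral>\<^sup>+y\<in>(\<Union>j. V j). ennreal (psi s ((x i - y) /\<^sub>R r)) \<partial>\<mu>) \<le>
        (\<integral>\<^sup>+y. ennreal (psi s ((x i - y) /\<^sub>R r)) \<partial>\<mu>)"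
      by (intro nn_integral_mono) (auto simp: indicator_def)
    also have "\<dots> \<le> ennreal (r powr t)"
      using t[OF x(1)] by (simp add: ennreal_FH_kernel[OF s \<mu>, symmetric] ennreal_leI)
    also have "ennreal (r powr (- t)) * ennreal (r powr t) = 1"
      using r by (simp add: ennreal_mult[symmetric] powr_add[symmetric])
    finally show ?thesis by (simp add: mult_left_mono)
  qed
  have pack: "psi_packing s \<delta> A (\<lambda>j. (w j, x j, r))"
    using x(1) \<open>B \<subseteq> A\<close> r w0 sum_le by (auto simp: psi_packing_def intro!: SUP_least)
  have "ennreal (2 powr (\<alpha> - s) * r powr (\<alpha> - t)) * emeasure \<mu> (\<Union>j. V j) =
     (\<Sum>j. ennreal (2 powr (\<alpha> - s) * r powr (\<alpha> - t)) * emeasure \<mu> (V j))"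
    using V by (simp add: suminf_emeasure[symmetric] ennreal_suminf_cmult)
  also have "\<dots> = (\<Sum>j. ennreal (w j * (2 * r) powr \<alpha>))"
    using r by (intro arg_cong[where f=suminf] ext)
      (simp add: w_def emeasure_eq_measure ennreal_mult[symmetric] powr_mult powr_diff powr_minus field_simps)
  also have "\<dots> \<le> packing_sup \<alpha> s A \<delta>"
    unfolding packing_sup_def using pack by (intro SUP_upper2[of "\<lambda>j. (w j, x j, r)"]) auto
  finally have "ennreal (2 powr (\<alpha> - s) * r powr (\<alpha> - t)) * emeasure \<mu> (\<Union>j. V j) \<le> packing_sup \<alpha> s A \<delta>" .
  moreover have "B \<subseteq> (\<Union>j. V j)"
  proof
    fix y assume "y \<in> B"
    moreover obtain j where "y \<in> C j" using C(2) by blast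
    ultimately show "y \<in> (\<Union>j. V j)" by (auto simp: V_def)
  qed
  moreover have "(\<Union>j. V j) \<in> sets \<mu>" using V by blast
  ultimately show ?thesis by blast
qed

text \<open>One bound \<open>K\<close> serves all scales below \<open>\<delta>\<close>, so the hulls
  \<open>U n\<close> have geometrically decreasing mass. Each point of \<open>A\<close> lies in
  infinitely many of them.\<close>

lemma packing_premeasure_finite_imp_null:
  fixes A :: "'a::euclidean_space set"
  assumes s: "s \<ge> 0" and \<mu>: "finite_borel_measure \<mu>" and "0 \<le> t" "\<alpha> < t"
    and fin: "packing_premeasure \<alpha> s A < \<infinity>"
    and A: "\<And>x. x \<in> A \<Longrightarrow> Liminf (at_right 0) (\<lambda>r. ennreal (FH_kernel s \<mu> x r / r powr t)) = 0"
  shows "\<exists>N\<in>null_sets \<mu>. A \<subseteq> N"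
proof -
  have "finite_measure \<mu>" using \<mu> by (simp add: finite_borel_measure_def)
  then interpret finite_measure \<mu> .
  obtain \<delta> where \<delta>: "\<delta> > 0" "packing_sup \<alpha> s A \<delta> < \<infinity>"
    using fin by (auto simp: packing_premeasure_eq_INF INF_less_iff)
  then obtain K where K: "packing_sup \<alpha> s A \<delta> = ennreal K" "K \<ge> 0"
    by (cases "packing_sup \<alpha> s A \<delta>") auto
  obtain n0 where n0: "(1/2::real) ^ n0 < \<delta>"
    using real_arch_pow_inv[OF \<delta>(1), of "1/2"] by auto
  \<comment> \<open>The shift by \<open>n0\<close> keeps every scale below
    \<open>\<delta>\<close>.\<close>
  define r where "r n = (1/2::real) ^ (n + n0)" for n
  have r: "0 < r n" "r n \<le> \<delta>" for n
    using n0 power_decreasing[of n0 "n + n0" "1/2::real"] unfolding r_def by (simp, linarith)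
  define B where "B n = {x\<in>A. FH_kernel s \<mu> x (r n) \<le> r n powr t}" for n
  have "\<exists>U\<in>sets \<mu>. B n \<subseteq> U \<and>
    ennreal (2 powr (\<alpha> - s) * r n powr (\<alpha> - t)) * emeasure \<mu> U \<le> ennreal K" for n
    unfolding K(1)[symmetric] by (rule packing_sup_ge_single_scale[OF s \<mu> r]) (auto simp: B_def)
  then obtain U where U: "\<And>n. U n \<in> sets \<mu>" "\<And>n. B n \<subseteq> U n"
    "\<And>n. ennreal (2 powr (\<alpha> - s) * r n powr (\<alpha> - t)) * emeasure \<mu> (U n) \<le> ennreal K"
    by metis
  define q where "q = (1/2::real) powr (t - \<alpha>)"
  have q: "0 < q" "q < 1" using \<open>\<alpha> < t\<close> by (auto simp: q_def powr01_less_one)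
  have "measure \<mu> (U n) \<le> K * 2 powr (s - \<alpha>) * q ^ n0 * q ^ n" for n
  proof -
    have "2 powr (\<alpha> - s) * r n powr (\<alpha> - t) * measure \<mu> (U n) \<le> K"
      using U(3)[of n] K(2) by (simp add: emeasure_eq_measure ennreal_mult[symmetric])
    then have "measure \<mu> (U n) \<le> K * 2 powr (s - \<alpha>) * r n powr (t - \<alpha>)"
      using r[of n] by (simp add: powr_diff field_simps)
    also have "r n powr (t - \<alpha>) = q ^ n0 * q ^ n"
      by (simp add: r_def q_def powr_power flip: powr_realpow powr_add) (simp add: powr_powr algebra_simps flip: powr_add)
    finally show ?thesis by (simp add: mult_ac)
  qed
  then have "summable (\<lambda>n. measure \<mu> (U n))"
    using q by (intro summable_comparison_test'[OF summable_mult[OF summable_geometric[of q]]]) auto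
  then have "AE x in \<mu>. \<forall>\<^sub>F n in sequentially. x \<in> space \<mu> - U n"
    using U(1) by (intro borel_cantelli_AE1) (auto simp: emeasure_eq_measure)
  then obtain N where N: "N \<in> null_sets \<mu>"
      "{x\<in>space \<mu>. \<not> (\<forall>\<^sub>F n in sequentially. x \<in> space \<mu> - U n)} \<subseteq> N"
    by (elim AE_E) (auto simp: null_sets_def)
  have "A \<subseteq> N"
  proof
    fix x assume x: "x \<in> A"
    have "space \<mu> = UNIV" using \<mu> sets_eq_imp_space_eq[of \<mu> borel] by (simp add: finite_borel_measure_def)
    moreover have "\<not> (\<forall>\<^sub>F n in sequentially. x \<in> space \<mu> - U n)"
    proof
      assume "\<forall>\<^sub>F n in sequentially. x \<in> space \<mu> - U n"
      then obtain n1 where n1: "\<And>n. n \<ge> n1 \<Longrightarrow> x \<notin> U n" by (auto simp: eventually_sequentially)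
      obtain m where m: "m \<ge> n0 + n1" "FH_kernel s \<mu> x ((1/2)^m) \<le> ((1/2)^m) powr t"
        using Liminf_FH_kernel_0_dyadic[OF s \<mu> \<open>0 \<le> t\<close> A[OF x]] by blast
      then have "x \<in> B (m - n0)" using x by (simp add: B_def r_def)
      moreover have "x \<notin> U (m - n0)" using m(1) by (intro n1) simp
      ultimately show False using U(2) by auto
    qed
    ultimately show "x \<in> N" using N(2) by auto
  qed
  with N show ?thesis by blast
qed

text \<open>A countable basis shows that the complement of the support is covered by countably many
  null open sets.\<close>

lemma AE_in_measure_support:
  fixes \<mu> :: "'a::second_countable_topology measure"
  assumes "sets \<mu> = sets borel"
  shows "AE x in \<mu>. x \<in> measure_support \<mu>"
proof -
  obtain B :: "'a set set" where B: "countable B" "topological_basis B"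
    using ex_countable_basis by blast
  define N where "N = \<Union>{b\<in>B. emeasure \<mu> b = 0}"
  have "N \<in> null_sets \<mu>"
    unfolding N_def using B topological_basis_open[OF B(2)] assms
    by (intro null_sets_UN'[where N="\<lambda>b. b", simplified]) (auto simp: null_sets_def)
  moreover have "x \<in> N" if "x \<notin> measure_support \<mu>" for x
  proof -
    from that obtain U where U: "open U" "x \<in> U" "emeasure \<mu> U = 0"
      by (auto simp: measure_support_def)
    then obtain b where "b \<in> B" "x \<in> b" "b \<subseteq> U"
      using topological_basisE[OF B(2)] by metis
    with U assms have "emeasure \<mu> b = 0" using emeasure_mono[of b U \<mu>] by auto
    then show ?thesis using \<open>b \<in> B\<close> \<open>x \<in> b\<close> by (auto simp: N_def)
  qed
  ultimately show ?thesis by (intro AE_I'[of N]) auto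
qed

lemma Dim_le_P_dim:
  fixes E :: "'a::euclidean_space set"
  assumes "s \<ge> 0"
  shows "Dim s E \<le> P_dim s E"
  unfolding Dim_def Dim_measure_def P_dim_def
proof (intro SUP_least INF_greatest, safe)
  fix \<mu> :: "'a measure" and t \<alpha> :: real
  assume \<mu>: "\<mu> \<in> Mc_plus E" and t: "0 \<le> t"
    and AE: "AE x in \<mu>. Liminf (at_right 0) (\<lambda>r. ennreal (FH_kernel s \<mu> x r / r powr t)) = 0"
    and \<alpha>: "0 < \<alpha>" "packing_measure \<alpha> s E = 0"
  have fbm: "finite_borel_measure \<mu>" and sets: "sets \<mu> = sets borel"
    and pos: "emeasure \<mu> (space \<mu>) \<noteq> 0" and supp: "measure_support \<mu> \<subseteq> E"
    using \<mu> by (auto simp: Mc_plus_def finite_borel_measure_def)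
  show "ennreal t \<le> ennreal \<alpha>"
  proof (rule ccontr)
    assume "\<not> ennreal t \<le> ennreal \<alpha>"
    then have "\<alpha> < t" using \<alpha> by (meson ennreal_leI not_le)
    have "packing_measure \<alpha> s E < \<infinity>" using \<alpha> by simp
    then obtain Es where Es: "E \<subseteq> (\<Union>k. Es k)" "(\<Sum>k. packing_premeasure \<alpha> s (Es k)) < \<infinity>"
      unfolding packing_measure_def INF_less_iff by auto
    \<comment> \<open>The liminf vanishes only almost everywhere, whereas the nullity lemma asks for
      it at every point. Hence the covering sets are first cut down to \<open>?G\<close>.\<close>
    let ?G = "{x. Liminf (at_right 0) (\<lambda>r. ennreal (FH_kernel s \<mu> x r / r powr t)) = 0}"
    have "\<exists>N\<in>null_sets \<mu>. Es k \<inter> ?G \<subseteq> N" for k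
    proof (rule packing_premeasure_finite_imp_null[OF assms fbm t \<open>\<alpha> < t\<close>])
      have "packing_premeasure \<alpha> s (Es k \<inter> ?G) \<le> packing_premeasure \<alpha> s (Es k)"
        by (intro packing_premeasure_mono) auto
      also have "\<dots> \<le> (\<Sum>k. packing_premeasure \<alpha> s (Es k))"
        using sum_le_suminf[of "\<lambda>k. packing_premeasure \<alpha> s (Es k)" "{k}"] by auto
      finally show "packing_premeasure \<alpha> s (Es k \<inter> ?G) < \<infinity>" using Es(2) by (rule le_less_trans)
    qed auto
    then have "\<forall>k. \<exists>N. N \<in> null_sets \<mu> \<and> Es k \<inter> ?G \<subseteq> N" by blast
    from choice[OF this] obtain N where N: "\<And>k. N k \<in> null_sets \<mu>" "\<And>k. Es k \<inter> ?G \<subseteq> N k"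
      by blast
    have "(\<Union>k. N k) \<in> null_sets \<mu>" using N by auto
    then have "AE x in \<mu>. x \<notin> (\<Union>k. N k)" by (rule AE_not_in)
    with AE AE_in_measure_support[OF sets] have "AE x in \<mu>. False"
    proof eventually_elim
      case (elim x)
      then obtain k where "x \<in> Es k" using supp Es(1) by auto
      then have "x \<in> N k" using elim N(2) by auto
      then show ?case using elim by auto
    qed
    then have "ae_filter \<mu> = bot" by (simp add: trivial_limit_def)
    then show False using pos by (simp add: ae_filter_eq_bot_iff)
  qed
qed

subsection \<open>Packings produce finitely supported measures with small potentials\<close>

lemma sum_power_le:
  fixes q :: real
  assumes "0 \<le> q" "q < 1" "finite F" "\<And>k. k \<in> F \<Longrightarrow> n \<le> k"
  shows "(\<Sum>k\<in>F. q ^ k) \<le> q ^ n / (1 - q)"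
proof -
  have "(\<Sum>k\<in>F. q ^ k) = (\<Sum>k\<in>F. q ^ n * q ^ (k - n))"
    using assms(4) by (intro sum.cong refl) (simp flip: power_add)
  also have "\<dots> = q ^ n * (\<Sum>j\<in>(\<lambda>k. k - n) ` F. q ^ j)"
    using assms(4) by (subst sum.reindex) (auto simp: sum_distrib_left intro!: inj_on_diff_nat)
  also have "(\<Sum>j\<in>(\<lambda>k. k - n) ` F. q ^ j) \<le> (\<Sum>j. q ^ j)"
    using assms by (intro sum_le_suminf summable_geometric) auto
  also have "(\<Sum>j. q ^ j) = 1 / (1 - q)"
    using assms by (intro suminf_geometric) auto
  finally show ?thesis using assms by (simp add: mult_left_mono)
qed

text \<open>A probability measure with weights \<open>p\<close> on the finite set \<open>Y\<close>,
  whose potential at scale \<open>(1/2) ^ m\<close> is small at its own atoms.\<close>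

definition dyadic_spread ::
  "real \<Rightarrow> real \<Rightarrow> nat \<Rightarrow> 'a::euclidean_space set \<Rightarrow> ('a \<Rightarrow> real) \<Rightarrow> bool" where
  "dyadic_spread s \<beta> m Y p \<longleftrightarrow> finite Y \<and> Y \<noteq> {} \<and> (\<forall>y\<in>Y. 0 \<le> p y) \<and> sum p Y = 1 \<and>
     (\<forall>x\<in>Y. (\<Sum>y\<in>Y. p y * psi s ((x - y) /\<^sub>R (1/2) ^ m)) \<le> ((1/2) ^ m) powr \<beta>)"

text \<open>Group the terms of a packing with large sum by dyadic radius. Since
  \<open>\<beta> < \<alpha>\<close>, the powers of order \<open>\<alpha> - \<beta>\<close> are
  summable over the scales, so some group has total weight \<open>W k\<close> above
  \<open>((1/2) ^ k) powr (- \<beta>)\<close>. Normalising that group gives the spread.\<close>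

lemma packing_premeasure_pos_imp_dyadic_spread:
  fixes A :: "'a::euclidean_space set"
  assumes s: "s \<ge> 0" and \<alpha>: "0 \<le> \<alpha>" "\<beta> < \<alpha>" and pos: "packing_premeasure \<alpha> s A \<noteq> 0"
  shows "\<exists>m\<ge>n. \<exists>Y p. Y \<subseteq> A \<and> dyadic_spread s \<beta> m Y p"
proof -
  obtain c' where "0 < c'" "c' < packing_premeasure \<alpha> s A"
    using pos dense[of 0 "packing_premeasure \<alpha> s A"] by (auto simp: zero_less_iff_neq_zero)
  then obtain c where c: "c > 0" "ennreal c < packing_premeasure \<alpha> s A"
    by (cases c') (auto simp: ennreal_less_zero_iff)
  define q where "q = (1/2::real) powr (\<alpha> - \<beta>)"
  have q: "0 < q" "q < 1" using \<alpha> by (auto simp: q_def powr01_less_one)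
  \<comment> \<open>Makes the tail of the geometric series smaller than \<open>c\<close>. The
    constant \<open>4 powr \<alpha>\<close> arises from
    \<open>2 * r i \<le> 4 * (1/2) ^ m i\<close>.\<close>
  obtain n1 where n1: "q ^ n1 < c * (1 - q) / 4 powr \<alpha>"
    using real_arch_pow_inv[of "c * (1 - q) / 4 powr \<alpha>" q] c q by auto
  define N where "N = max n n1"
  have "q ^ N \<le> q ^ n1" using q by (intro power_decreasing) (auto simp: N_def)
  with n1 have "q ^ N < c * (1 - q) / 4 powr \<alpha>" by (rule order.strict_trans1[rotated])
  then have qN: "4 powr \<alpha> * (q ^ N / (1 - q)) < c"
    using q by (simp add: field_simps)
  have "ennreal c < packing_sup \<alpha> s A ((1/2) ^ N)"
    using c(2) unfolding packing_premeasure_eq_INF by (rule less_INF_D) simp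
  then obtain T where T: "psi_packing s ((1/2) ^ N) A T"
    "ennreal c < (\<Sum>i. case T i of (w, _, r) \<Rightarrow> ennreal (w * (2 * r) powr \<alpha>))"
    by (auto simp: packing_sup_def less_SUP_iff)
  define w where "w i = fst (T i)" for i
  define x where "x i = fst (snd (T i))" for i
  define r where "r i = snd (snd (T i))" for i
  have Ti: "T i = (w i, x i, r i)" for i by (simp add: w_def x_def r_def)
  have w: "w i \<ge> 0" and x: "x i \<in> A" and r: "0 < r i" "r i \<le> (1/2) ^ N"
    and le1: "(\<Sum>j. ennreal (w j * psi s ((x i - x j) /\<^sub>R r j))) \<le> 1" for i
    using T(1) by (auto simp: psi_packing_def Ti SUP_le_iff)
  have "ennreal c < (\<Sum>i. ennreal (w i * (2 * r i) powr \<alpha>))"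
    using T(2) by (simp add: Ti)
  then obtain L where "ennreal c < (\<Sum>i<L. ennreal (w i * (2 * r i) powr \<alpha>))"
    by (auto simp: suminf_eq_SUP less_SUP_iff)
  then have L: "c < (\<Sum>i<L. w i * (2 * r i) powr \<alpha>)"
    using w r c by (simp add: sum_ennreal ennreal_less_iff sum_nonneg)
  have "\<forall>i. \<exists>m\<ge>N. (1/2) ^ m \<le> r i \<and> r i \<le> 2 * (1/2::real) ^ m"
    using dyadic_between r by blast
  then obtain m where m: "\<And>i. m i \<ge> N" "\<And>i. (1/2) ^ m i \<le> r i" "\<And>i. r i \<le> 2 * (1/2::real) ^ m i"
    by metis
  define J where "J k = {i\<in>{..<L}. m i = k}" for k
  define W where "W k = sum w (J k)" for k
  have "\<exists>k\<ge>N. W k * ((1/2) ^ k) powr \<beta> > 1"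
  proof (rule ccontr)
    assume neg: "\<not> ?thesis"
    have "(\<Sum>i<L. w i * (2 * r i) powr \<alpha>) \<le> (\<Sum>i<L. w i * (4 powr \<alpha> * ((1/2) ^ m i) powr \<alpha>))"
    proof (intro sum_mono mult_left_mono w)
      fix i
      have "(2 * r i) powr \<alpha> \<le> (4 * (1/2) ^ m i) powr \<alpha>"
        using m(3)[of i] r(1)[of i] \<alpha> by (intro powr_mono2) auto
      then show "(2 * r i) powr \<alpha> \<le> 4 powr \<alpha> * ((1/2) ^ m i) powr \<alpha>" by (simp add: powr_mult)
    qed
    also have "\<dots> = (\<Sum>k\<in>m ` {..<L}. \<Sum>i\<in>J k. w i * (4 powr \<alpha> * ((1/2) ^ m i) powr \<alpha>))"
      unfolding J_def by (rule sum.group[symmetric]) auto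
    also have "\<dots> = (\<Sum>k\<in>m ` {..<L}. 4 powr \<alpha> * (((1/2) ^ k) powr (\<alpha> - \<beta>) * (W k * ((1/2) ^ k) powr \<beta>)))"
    proof (intro sum.cong refl)
      fix k
      have "(\<Sum>i\<in>J k. w i * (4 powr \<alpha> * ((1/2) ^ m i) powr \<alpha>)) = W k * (4 powr \<alpha> * ((1/2) ^ k) powr \<alpha>)"
        by (simp add: W_def J_def sum_distrib_right)
      also have "((1/2::real) ^ k) powr \<alpha> = ((1/2) ^ k) powr (\<alpha> - \<beta>) * ((1/2) ^ k) powr \<beta>"
        by (simp flip: powr_add)
      finally show "(\<Sum>i\<in>J k. w i * (4 powr \<alpha> * ((1/2) ^ m i) powr \<alpha>)) =
         4 powr \<alpha> * (((1/2) ^ k) powr (\<alpha> - \<beta>) * (W k * ((1/2) ^ k) powr \<beta>))" by (simp add: mult_ac)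
    qed
    also have "\<dots> \<le> (\<Sum>k\<in>m ` {..<L}. 4 powr \<alpha> * (q ^ k * 1))"
    proof (intro sum_mono mult_mono)
      fix k assume "k \<in> m ` {..<L}"
      then have "N \<le> k" using m(1) by auto
      then show "W k * ((1/2) ^ k) powr \<beta> \<le> 1" using neg by (auto simp: not_less)
      show "((1/2) ^ k) powr (\<alpha> - \<beta>) \<le> q ^ k"
        by (simp add: q_def powr_power powr_powr mult_ac flip: powr_realpow)
    qed (use q w in \<open>auto simp: W_def sum_nonneg\<close>)
    also have "\<dots> = 4 powr \<alpha> * (\<Sum>k\<in>m ` {..<L}. q ^ k)" by (simp add: sum_distrib_left)
    also have "\<dots> \<le> 4 powr \<alpha> * (q ^ N / (1 - q))"
      using q m(1) by (intro mult_left_mono sum_power_le) auto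
    also note qN
    finally show False using L by simp
  qed
  then obtain k where k: "k \<ge> N" "W k * ((1/2) ^ k) powr \<beta> > 1" by blast
  have Wpos: "W k > 0" using k(2) by (smt (verit) mult_nonpos_nonneg powr_ge_zero)
  have finJ: "finite (J k)" by (simp add: J_def)
  define Y where "Y = x ` J k"
  \<comment> \<open>Several indices may share a centre; their weights are added.\<close>
  define p where "p y = (\<Sum>j\<in>{j\<in>J k. x j = y}. w j) / W k" for y
  have sum_p: "(\<Sum>y\<in>Y. p y * h y) = (\<Sum>j\<in>J k. w j * h (x j)) / W k" for h
  proof -
    have "(\<Sum>y\<in>Y. p y * h y) = (\<Sum>y\<in>Y. \<Sum>j\<in>{j\<in>J k. x j = y}. w j * h (x j)) / W k"
      unfolding sum_divide_distrib by (intro sum.cong refl) (simp add: p_def sum_distrib_right flip: sum_divide_distrib)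
    also have "(\<Sum>y\<in>Y. \<Sum>j\<in>{j\<in>J k. x j = y}. w j * h (x j)) = (\<Sum>j\<in>J k. w j * h (x j))"
      using finJ by (intro sum.group) (auto simp: Y_def)
    finally show ?thesis .
  qed
  \<comment> \<open>Dropping the other indices and shrinking radii to the dyadic scale only lowers
    the potential, which stays at most 1. Division by \<open>W k\<close> then gives the
    bound.\<close>
  have "(\<Sum>y\<in>Y. p y * psi s ((x i - y) /\<^sub>R (1/2) ^ k)) \<le> ((1/2) ^ k) powr \<beta>" for i
  proof -
    have "ennreal (\<Sum>j\<in>J k. w j * psi s ((x i - x j) /\<^sub>R r j)) \<le> (\<Sum>j. ennreal (w j * psi s ((x i - x j) /\<^sub>R r j)))"
      using w finJ by (subst sum_ennreal[symmetric]) (auto intro!: sum_le_suminf mult_nonneg_nonneg psi_nonneg)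
    also have "\<dots> \<le> ennreal 1" using le1 by simp
    finally have "(\<Sum>j\<in>J k. w j * psi s ((x i - x j) /\<^sub>R r j)) \<le> 1"
      by (subst (asm) ennreal_le_iff) auto
    moreover have "(\<Sum>j\<in>J k. w j * psi s ((x i - x j) /\<^sub>R (1/2) ^ k)) \<le> (\<Sum>j\<in>J k. w j * psi s ((x i - x j) /\<^sub>R r j))"
      using m(2) s w by (intro sum_mono mult_left_mono psi_divideR_mono) (auto simp: J_def)
    ultimately have "(\<Sum>j\<in>J k. w j * psi s ((x i - x j) /\<^sub>R (1/2) ^ k)) \<le> W k * ((1/2) ^ k) powr \<beta>"
      using k(2) by linarith
    then show ?thesis using Wpos by (simp add: sum_p field_simps)
  qed
  moreover have "sum p Y = 1" using sum_p[of "\<lambda>_. 1"] Wpos by (simp add: W_def)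
  moreover have "Y \<noteq> {}" using Wpos by (auto simp: Y_def W_def)
  ultimately have "dyadic_spread s \<beta> k Y p"
    using finJ Wpos w by (auto simp: dyadic_spread_def Y_def p_def intro!: divide_nonneg_pos sum_nonneg)
  moreover have "Y \<subseteq> A" using x by (auto simp: Y_def)
  moreover have "k \<ge> n" using k by (simp add: N_def)
  ultimately show ?thesis by blast
qed

text \<open>In a bounded set all mutual distances are at most some \<open>D\<close>, so the
  potential of any probability measure on it is at least \<open>(r / D) powr s\<close>. For
  \<open>\<beta> > s\<close> and small \<open>r\<close> this exceeds \<open>r powr \<beta>\<close>,
  and no spread can exist.\<close>

lemma packing_premeasure_bounded_pos_imp_le:
  fixes A :: "'a::euclidean_space set"
  assumes s: "s \<ge> 0" and \<alpha>: "0 \<le> \<alpha>" and pos: "packing_premeasure \<alpha> s A \<noteq> 0" and "bounded A"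
  shows "\<alpha> \<le> s"
proof (rule ccontr)
  assume "\<not> \<alpha> \<le> s"
  then obtain \<beta> where \<beta>: "s < \<beta>" "\<beta> < \<alpha>" using dense[of s \<alpha>] by auto
  obtain D0 where D0: "\<And>x. x \<in> A \<Longrightarrow> norm x \<le> D0" using \<open>bounded A\<close> by (auto simp: bounded_iff)
  define D where "D = max 1 (2 * D0)"
  \<comment> \<open>The solution of \<open>e powr (\<beta> - s) = (1 / D) powr s\<close>, at which
    the two bounds on the potential meet up to the common factor.\<close>
  define e where "e = (1 / D) powr (s / (\<beta> - s))"
  have D: "D \<ge> 1" by (simp add: D_def)
  then have e: "e > 0" by (simp add: e_def)
  then obtain n where n: "(1/2::real) ^ n < e" using real_arch_pow_inv[of e "1/2"] by auto
  obtain m Y p where m: "m \<ge> n" and Y: "Y \<subseteq> A" "dyadic_spread s \<beta> m Y p"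
    using packing_premeasure_pos_imp_dyadic_spread[OF s \<alpha> \<beta>(2) pos] by blast
  define r where "r = (1/2::real) ^ m"
  have r: "0 < r" "r \<le> 1" "r < e"
    using n power_decreasing[OF m, of "1/2::real"] unfolding r_def by (auto simp: power_le_one simp del: power_decreasing_iff)
  obtain x where x: "x \<in> Y" using Y by (auto simp: dyadic_spread_def)
  have "(r / D) powr s = (\<Sum>y\<in>Y. p y * (r / D) powr s)"
    using Y by (simp add: dyadic_spread_def flip: sum_distrib_right)
  also have "\<dots> \<le> (\<Sum>y\<in>Y. p y * psi s ((x - y) /\<^sub>R r))"
  proof (intro sum_mono mult_left_mono psi_divideR_ge)
    fix y assume y: "y \<in> Y"
    show "norm (x - y) \<le> D"
      using norm_triangle_ineq4[of x y] D0[of x] D0[of y] x y Y(1) by (fastforce simp: D_def)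
  qed (use Y r D s in \<open>auto simp: dyadic_spread_def\<close>)
  also have "\<dots> \<le> r powr \<beta>" using Y x by (auto simp: dyadic_spread_def r_def)
  also have "r powr \<beta> = r powr s * r powr (\<beta> - s)" by (simp flip: powr_add)
  finally have "r powr s * (1 / D) powr s \<le> r powr s * r powr (\<beta> - s)" using r D by (simp add: powr_divide)
  then have "(1 / D) powr s \<le> r powr (\<beta> - s)" using r by (subst (asm) mult_le_cancel_left_pos) auto
  also have "\<dots> < e powr (\<beta> - s)" using r \<beta> by (intro powr_less_mono2) auto
  also have "\<dots> = (1 / D) powr s" using \<beta> by (simp add: e_def powr_powr)
  finally show False by simp
qed

text \<open>
  Thin sets form a \<open>\<sigma>\<close>-ideal by construction, which spares a proof that the packing measure is
  countably subadditive.
\<close>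

definition packing_thin :: "real \<Rightarrow> real \<Rightarrow> 'a::euclidean_space set \<Rightarrow> bool" where
  "packing_thin \<alpha> s A \<longleftrightarrow> (\<exists>\<C>. countable \<C> \<and> A \<subseteq> \<Union>\<C> \<and> (\<forall>C\<in>\<C>. packing_premeasure \<alpha> s C = 0))"

lemma packing_thin_UN:
  assumes "countable I" "\<And>i. i \<in> I \<Longrightarrow> packing_thin \<alpha> s (A i)"
  shows "packing_thin \<alpha> s (\<Union>i\<in>I. A i)"
proof -
  obtain \<C> where "\<And>i. i \<in> I \<Longrightarrow> countable (\<C> i) \<and> A i \<subseteq> \<Union>(\<C> i) \<and> (\<forall>C\<in>\<C> i. packing_premeasure \<alpha> s C = 0)"
    using assms(2) unfolding packing_thin_def by metis
  then show ?thesis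
    using assms(1) unfolding packing_thin_def by (intro exI[of _ "\<Union>i\<in>I. \<C> i"]) fastforce
qed

lemma packing_thin_subset: "packing_thin \<alpha> s B \<Longrightarrow> A \<subseteq> B \<Longrightarrow> packing_thin \<alpha> s A"
  unfolding packing_thin_def by (meson order_trans)

lemma packing_thinI: "packing_premeasure \<alpha> s A = 0 \<Longrightarrow> packing_thin \<alpha> s A"
  unfolding packing_thin_def by (intro exI[of _ "{A}"]) auto

lemma packing_premeasure_empty: "packing_premeasure \<alpha> s {} = 0"
proof -
  have "packing_sup \<alpha> s {} 1 = 0" by (auto simp: packing_sup_def psi_packing_def bot_ennreal split: prod.splits)
  then have "packing_premeasure \<alpha> s {} \<le> 0"
    unfolding packing_premeasure_eq_INF by (intro INF_lower2[of 1]) auto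
  then show ?thesis by simp
qed

lemma packing_thin_imp_packing_measure_0:
  assumes "packing_thin \<alpha> s A" shows "packing_measure \<alpha> s A = 0"
proof -
  obtain \<C> where \<C>: "countable \<C>" "A \<subseteq> \<Union>\<C>" "\<And>C. C \<in> \<C> \<Longrightarrow> packing_premeasure \<alpha> s C = 0"
    using assms by (auto simp: packing_thin_def)
  \<comment> \<open>The empty set is inserted so that the enumeration also works for an empty
    family.\<close>
  define Es where "Es = from_nat_into (insert {} \<C>)"
  have "range Es = insert {} \<C>" using \<C>(1) by (simp add: Es_def range_from_nat_into)
  moreover have "packing_premeasure \<alpha> s C = 0" if "C \<in> insert {} \<C>" for C
    using that \<C>(3) packing_premeasure_empty by auto
  ultimately have "A \<subseteq> (\<Union>k. Es k)" "\<forall>k. packing_premeasure \<alpha> s (Es k) = 0"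
    using \<C>(2) by (auto, metis rangeI)
  then have "packing_measure \<alpha> s A \<le> 0"
    unfolding packing_measure_def by (intro INF_lower2[of Es]) auto
  then show ?thesis by simp
qed

subsection \<open>The Baire space\<close>

definition cyl :: "(nat \<Rightarrow> nat) \<Rightarrow> nat \<Rightarrow> (nat \<Rightarrow> nat) set" where
  "cyl z k = {y. \<forall>i<k. y i = z i}"

lemma cyl_antimono: "k \<le> l \<Longrightarrow> cyl z l \<subseteq> cyl z k"
  by (auto simp: cyl_def)

lemma cyl_trans: "x \<in> cyl y l \<Longrightarrow> y \<in> cyl z k \<Longrightarrow> k \<le> l \<Longrightarrow> x \<in> cyl z k"
  by (auto simp: cyl_def)

lemma cyl_self: "z \<in> cyl z k"
  by (simp add: cyl_def)

text \<open>A basic open set of the product topology constrains only finitely many coordinates,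
  hence contains a cylinder about each of its points.\<close>

lemma continuous_on_cyl:
  fixes f :: "(nat \<Rightarrow> nat) \<Rightarrow> 'a::real_normed_vector"
  assumes "continuous_on UNIV f" "0 < e"
  shows "\<exists>k. \<forall>y\<in>cyl z k. norm (f y - f z) \<le> e"
proof -
  have "open (f -` ball (f z) e)" using assms by (intro open_vimage) auto
  then have "openin (product_topology (\<lambda>i. euclidean) UNIV) (f -` ball (f z) e)"
    by (simp add: open_fun_def)
  moreover have "z \<in> f -` ball (f z) e" using assms by simp
  ultimately have "\<exists>X. z \<in> PiE UNIV X \<and> (\<forall>i. openin euclidean (X i)) \<and>
      finite {i. X i \<noteq> topspace euclidean} \<and> PiE UNIV X \<subseteq> f -` ball (f z) e"
    by (rule product_topology_open_contains_basis)
  then obtain X where X: "z \<in> PiE UNIV X" "finite {i. X i \<noteq> UNIV}" "PiE UNIV X \<subseteq> f -` ball (f z) e"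
    by (elim exE conjE) simp
  define k where "k = Suc (Max (insert 0 {i. X i \<noteq> UNIV}))"
  have "X i = UNIV" if "i \<ge> k" for i
  proof (rule ccontr)
    assume "X i \<noteq> UNIV"
    then have "i \<le> Max (insert 0 {i. X i \<noteq> UNIV})" using X(2) by (intro Max_ge) auto
    with that show False by (simp add: k_def)
  qed
  have "norm (f y - f z) \<le> e" if "y \<in> cyl z k" for y
  proof -
    have "y i \<in> X i" for i
      using that X(1) \<open>\<And>i. i \<ge> k \<Longrightarrow> X i = UNIV\<close>[of i] by (cases "i < k") (auto simp: cyl_def PiE_def Pi_def)
    then show ?thesis using X(3) by (force simp: PiE_def Pi_def dist_norm norm_minus_commute)
  qed
  then show ?thesis by blast
qed

lemma continuous_on_cyl_uniform:
  fixes f :: "(nat \<Rightarrow> nat) \<Rightarrow> 'a::real_normed_vector"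
  assumes "continuous_on UNIV f" "0 < e" "finite S"
  shows "\<exists>k\<ge>l. \<forall>z\<in>S. \<forall>y\<in>cyl z k. norm (f y - f z) \<le> e"
proof -
  obtain K where K: "\<And>z y. y \<in> cyl z (K z) \<Longrightarrow> norm (f y - f z) \<le> e"
    using continuous_on_cyl[OF assms(1,2)] by metis
  define k where "k = Max (insert l (K ` S))"
  have "K z \<le> k" if "z \<in> S" for z using that assms(3) unfolding k_def by (intro Max_ge) auto
  moreover have "l \<le> k" using assms(3) unfolding k_def by (intro Max_ge) auto
  ultimately show ?thesis using K cyl_antimono by (meson subsetD)
qed

lemma compact_finitely_branching:
  fixes A :: "nat \<Rightarrow> nat set"
  assumes "\<And>j. finite (A j)" shows "compact {z. \<forall>j. z j \<in> A j}"
proof -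
  have "compactin (product_topology (\<lambda>i. euclidean) UNIV) (PiE UNIV A)"
    unfolding compactin_PiE using assms by (auto intro: finite_imp_compact)
  moreover have "PiE UNIV A = {z. \<forall>j. z j \<in> A j}" by auto
  ultimately show ?thesis by (simp add: euclidean_product_topology)
qed

text \<open>Remove all cylinders with thin image. There are only countably many cylinders, so the
  removed part has thin image, and cutting a surviving cylinder down to \<open>Z\<close> cannot make
  its image thin.\<close>

lemma not_packing_thin_kernel:
  fixes f :: "(nat \<Rightarrow> nat) \<Rightarrow> 'a::euclidean_space"
  assumes "\<not> packing_thin \<alpha> s (range f)"
  shows "\<exists>Z. Z \<noteq> {} \<and> (\<forall>z\<in>Z. \<forall>k. \<not> packing_thin \<alpha> s (f ` (Z \<inter> cyl z k)))"
proof -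
  define Z where "Z = {z. \<forall>k. \<not> packing_thin \<alpha> s (f ` cyl z k)}"
  \<comment> \<open>Indexing cylinders by finite lists makes their countability immediate.\<close>
  define W where "W l = {y. map y [0..<length l] = l}" for l :: "nat list"
  define I where "I = {l. packing_thin \<alpha> s (f ` W l)}"
  have cyl: "cyl z k = W (map z [0..<k])" for z k by (auto simp: cyl_def W_def)
  have thin: "packing_thin \<alpha> s (f ` (- Z))"
  proof (rule packing_thin_subset)
    show "packing_thin \<alpha> s (\<Union>l\<in>I. f ` W l)" by (rule packing_thin_UN) (auto simp: I_def)
    show "f ` (- Z) \<subseteq> (\<Union>l\<in>I. f ` W l)"
    proof safe
      fix z assume "z \<notin> Z"
      then obtain k where "packing_thin \<alpha> s (f ` cyl z k)" by (auto simp: Z_def)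
      then have "map z [0..<k] \<in> I" by (simp add: I_def cyl)
      moreover have "f z \<in> f ` W (map z [0..<k])" using cyl_self[of z k] by (simp add: cyl)
      ultimately show "f z \<in> (\<Union>l\<in>I. f ` W l)" by blast
    qed
  qed
  have "\<not> packing_thin \<alpha> s (f ` (Z \<inter> cyl z k))" if "z \<in> Z" for z k
  proof
    assume "packing_thin \<alpha> s (f ` (Z \<inter> cyl z k))"
    with thin have "packing_thin \<alpha> s (\<Union>A\<in>{f ` (- Z), f ` (Z \<inter> cyl z k)}. A)"
      by (intro packing_thin_UN) auto
    then have "packing_thin \<alpha> s (f ` cyl z k)" by (rule packing_thin_subset) auto
    then show False using that by (auto simp: Z_def)
  qed
  moreover have "Z \<noteq> {}" using thin assms by auto
  ultimately show ?thesis by blast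
qed

section \<open>Partitions of the unit interval with prescribed masses\<close>

definition unit_measure :: "real measure" where
  "unit_measure = uniform_measure lborel {0..1}"

lemma sets_unit_measure [simp, measurable_cong]: "sets unit_measure = sets borel"
  by (simp add: unit_measure_def)

lemma space_unit_measure [simp]: "space unit_measure = UNIV"
  by (simp add: unit_measure_def)

lemma measure_unit_measure:
  "A \<in> sets borel \<Longrightarrow> measure unit_measure A = measure lborel ({0..1} \<inter> A)"
  by (simp add: unit_measure_def)

lemma measure_unit_measure_UNIV [simp]: "measure unit_measure UNIV = 1"
  by (simp add: measure_unit_measure)

lemma finite_measure_unit_measure: "finite_measure unit_measure"
  by (rule finite_measureI) (simp add: unit_measure_def emeasure_uniform_measure)

text \<open>The mass of \<open>A\<close> to the left of \<open>t\<close> is a 1-Lipschitz function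
  of \<open>t\<close>, running from 0 at -1 to the full mass at 1. The intermediate value theorem
  gives a cut.\<close>

lemma unit_measure_split:
  assumes A: "A \<in> sets borel" and c: "0 \<le> c" "c \<le> measure unit_measure A"
  shows "\<exists>B\<in>sets borel. B \<subseteq> A \<and> measure unit_measure B = c"
proof -
  define F where "F t = measure unit_measure (A \<inter> {..t})" for t
  interpret finite_measure unit_measure by (rule finite_measure_unit_measure)
  have F_le: "F u \<le> F t + \<bar>u - t\<bar>" for t u
  proof -
    have "F u \<le> measure unit_measure ((A \<inter> {..t}) \<union> {t..u})"
      unfolding F_def using A by (intro finite_measure_mono) auto
    also have "\<dots> \<le> F t + measure unit_measure {t..u}"
      unfolding F_def using A by (intro measure_Un_le) auto
    also have "measure unit_measure {t..u} = measure lborel ({0..1} \<inter> {t..u})"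
      by (simp add: measure_unit_measure)
    also have "\<dots> \<le> \<bar>u - t\<bar>"
      by (auto simp: Int_atLeastAtMost min_def max_def)
    finally show ?thesis by simp
  qed
  then have "\<bar>F t - F u\<bar> \<le> \<bar>t - u\<bar>" for t u
    using F_le[of t u] F_le[of u t] by linarith
  then have "1-lipschitz_on UNIV F" by (auto simp: lipschitz_on_def dist_real_def)
  then have "continuous_on {-1..1} F"
    using lipschitz_on_continuous_on lipschitz_on_subset by blast
  moreover have "F (-1) = 0" "F 1 = measure unit_measure A"
  proof -
    have "{0..1} \<inter> (A \<inter> {..-1::real}) = {}" "{0..1} \<inter> (A \<inter> {..1::real}) = {0..1} \<inter> A" by auto
    then show "F (-1) = 0" "F 1 = measure unit_measure A" unfolding F_def using A by (auto simp: measure_unit_measure)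
  qed
  ultimately obtain t where "F t = c"
    using IVT'[of F "-1" c 1] c by auto
  then show ?thesis using A by (intro bexI[of _ "A \<inter> {..t}"]) (auto simp: F_def)
qed

text \<open>Cut off the piece for one point at a time. The function \<open>g\<close> is a random
  variable on \<open>A\<close> with the prescribed masses.\<close>

lemma unit_measure_partition:
  assumes "finite Y" "Y \<noteq> {}" "A \<in> sets borel" "\<And>y. y \<in> Y \<Longrightarrow> 0 \<le> q y" "sum q Y = measure unit_measure A"
  shows "\<exists>g. (\<forall>\<omega>\<in>A. g \<omega> \<in> Y) \<and>
    (\<forall>y\<in>Y. {\<omega>\<in>A. g \<omega> = y} \<in> sets borel \<and> measure unit_measure {\<omega>\<in>A. g \<omega> = y} = q y)"
  using assms
proof (induction arbitrary: A rule: finite_ne_induct)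
  case (singleton y)
  then show ?case by (intro exI[of _ "\<lambda>_. y"]) auto
next
  case (insert y Y)
  interpret finite_measure unit_measure by (rule finite_measure_unit_measure)
  have "q y \<le> measure unit_measure A"
    using insert.prems insert.hyps by (simp add: sum_nonneg flip: insert.prems(3))
  then obtain B where B: "B \<in> sets borel" "B \<subseteq> A" "measure unit_measure B = q y"
    using unit_measure_split[OF insert.prems(1), of "q y"] insert.prems by auto
  have "measure unit_measure (A - B) = sum q Y"
    using finite_measure_Diff[of A B] B insert by simp
  then have "\<exists>g. (\<forall>\<omega>\<in>A - B. g \<omega> \<in> Y) \<and> (\<forall>z\<in>Y. {\<omega>\<in>A - B. g \<omega> = z} \<in> sets borel \<and>
      measure unit_measure {\<omega>\<in>A - B. g \<omega> = z} = q z)"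
    using insert.prems(1,2) B(1) by (intro insert.IH) auto
  then obtain g where g: "\<And>\<omega>. \<omega> \<in> A - B \<Longrightarrow> g \<omega> \<in> Y"
    "\<And>z. z \<in> Y \<Longrightarrow> {\<omega>\<in>A - B. g \<omega> = z} \<in> sets borel \<and> measure unit_measure {\<omega>\<in>A - B. g \<omega> = z} = q z"
    by blast
  define h where "h \<omega> = (if \<omega> \<in> B then y else g \<omega>)" for \<omega>
  have "{\<omega>\<in>A. h \<omega> = y} = B" using g(1) B(2) insert.hyps by (auto simp: h_def)
  moreover have "{\<omega>\<in>A. h \<omega> = z} = {\<omega>\<in>A - B. g \<omega> = z}" if "z \<in> Y" for z
    using that insert.hyps by (auto simp: h_def)
  ultimately show ?case using g B by (intro exI[of _ h]) (auto simp: h_def)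
qed

subsection \<open>The tree construction\<close>

lemma finite_image_separation:
  fixes f :: "'b \<Rightarrow> 'a::real_normed_vector"
  assumes "finite S" "inj_on f S"
  shows "\<exists>\<delta>>0. \<forall>x\<in>S. \<forall>y\<in>S. x \<noteq> y \<longrightarrow> \<delta> \<le> norm (f x - f y)"
proof -
  \<comment> \<open>The element 1 keeps the minimum defined when \<open>S\<close> has at most one
    point.\<close>
  define D where "D = insert 1 ((\<lambda>(x, y). norm (f x - f y)) ` {(x, y) \<in> S \<times> S. x \<noteq> y})"
  have "finite {(x, y) \<in> S \<times> S. x \<noteq> y}"
    using assms(1) by (auto intro: finite_subset[of _ "S \<times> S"])
  then have D: "finite D" "D \<noteq> {}" by (auto simp: D_def)
  moreover have "\<forall>d\<in>D. 0 < d" using assms(2) by (auto simp: D_def inj_on_def)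
  ultimately have "0 < Min D" by (subst Min_gr_iff) auto
  moreover have "Min D \<le> norm (f x - f y)" if "x \<in> S" "y \<in> S" "x \<noteq> y" for x y
    using that D by (intro Min_le) (auto simp: D_def)
  ultimately show ?thesis by blast
qed

lemma dyadic_powr_le_powr:
  fixes s :: real
  assumes "\<beta> < s" "0 < d"
  shows "\<exists>n. \<forall>m\<ge>n. ((1/2) ^ m / d) powr s \<le> ((1/2) ^ m) powr \<beta>"
proof -
  \<comment> \<open>Solves \<open>e powr (s - \<beta>) = d powr s\<close>; the claim is equivalent
    to \<open>r powr (s - \<beta>) \<le> d powr s\<close> for \<open>r = (1/2) ^ m\<close>.\<close>
  define e where "e = (d powr s) powr (1 / (s - \<beta>))"
  have "e > 0" using assms by (auto simp: e_def)
  then obtain n where n: "(1/2::real) ^ n < e" using real_arch_pow_inv[of e "1/2"] by auto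
  have "((1/2) ^ m / d) powr s \<le> ((1/2) ^ m) powr \<beta>" if "n \<le> m" for m
  proof -
    define r where "r = (1/2::real) ^ m"
    have r: "0 < r" "r \<le> e"
      using n power_decreasing[OF that, of "1/2::real"] by (auto simp: r_def simp del: power_decreasing_iff)
    have "r powr (s - \<beta>) \<le> e powr (s - \<beta>)" using r assms by (intro powr_mono2) auto
    also have "\<dots> = d powr s" using assms by (simp add: e_def powr_powr)
    finally have "r powr \<beta> * r powr (s - \<beta>) \<le> r powr \<beta> * d powr s" by (intro mult_left_mono) auto
    then have "r powr s \<le> r powr \<beta> * d powr s" by (simp flip: powr_add)
    then have "(r / d) powr s \<le> r powr \<beta>" using r assms by (simp add: powr_divide divide_simps)
    then show ?thesis by (simp add: r_def)
  qed
  then show ?thesis by blast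
qed

text \<open>The spreads have atoms in the image of \<open>K\<close> itself, so each new atom can
  again be replaced by a spread. The condition \<open>\<beta> < s\<close> makes separated atoms
  negligible at small scales.\<close>

locale spread_tree =
  fixes f :: "(nat \<Rightarrow> nat) \<Rightarrow> 'a::euclidean_space" and K :: "(nat \<Rightarrow> nat) set" and s \<beta> :: real
  assumes s: "0 \<le> s" "\<beta> < s" and cont: "continuous_on UNIV f" and K: "K \<noteq> {}"
    and spread: "z \<in> K \<Longrightarrow> \<exists>m\<ge>n. \<exists>Y p. Y \<subseteq> f ` (K \<inter> cyl z k) \<and> dyadic_spread s \<beta> m Y p"
begin

text \<open>
  The \<open>n\<close>-th approximation \<open>f \<circ> Z\<close> of the limiting random variable takes finitely many values; \<open>R\<close> is the
  exponent of the dyadic scale at which the potential is small. Later stages stay in the cylinders of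
  length \<open>k\<close>. The last condition compares every value with the scale at every \<open>\<omega>\<close>, since both
  arguments of the kernel move.
\<close>

definition stage :: "nat \<Rightarrow> (real \<Rightarrow> nat \<Rightarrow> nat) \<times> (real \<Rightarrow> nat) \<times> nat \<Rightarrow> bool" where
  "stage n = (\<lambda>(Z, R, k).
     finite (range Z) \<and> (\<forall>z. Z -` {z} \<in> sets borel) \<and> range Z \<subseteq> K \<and> inj_on f (range Z) \<and>
     n \<le> k \<and> (\<forall>\<omega>. n \<le> R \<omega>) \<and>
     (\<forall>\<omega>. (\<integral>\<omega>'. psi s ((f (Z \<omega>) - f (Z \<omega>')) /\<^sub>R (1/2) ^ R \<omega>) \<partial>unit_measure) \<le> 2 * ((1/2) ^ R \<omega>) powr \<beta>) \<and>
     (\<forall>\<omega> \<omega>'. \<forall>y\<in>cyl (Z \<omega>') k. norm (f y - f (Z \<omega>')) \<le> (1/2) ^ R \<omega> / 2))"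

text \<open>Every preimage is a finite union of level sets of \<open>Z\<close>, which avoids a
  sigma-algebra on the Baire space.\<close>

lemma measurable_finite_range:
  fixes Z :: "real \<Rightarrow> nat \<Rightarrow> nat" and g :: "(nat \<Rightarrow> nat) \<Rightarrow> 'b::topological_space"
  assumes "finite (range Z)" "\<And>z. Z -` {z} \<in> sets borel"
  shows "(\<lambda>\<omega>. g (Z \<omega>)) \<in> borel_measurable borel"
proof (rule measurableI)
  fix A :: "'b set"
  have "(\<lambda>\<omega>. g (Z \<omega>)) -` A \<inter> space borel = (\<Union>z\<in>range Z \<inter> g -` A. Z -` {z})" by auto
  also have "\<dots> \<in> sets borel" using assms by auto
  finally show "(\<lambda>\<omega>. g (Z \<omega>)) -` A \<inter> space borel \<in> sets borel" .
qed simp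

text \<open>A constant map at scale 1: the potential is at most 1, since \<open>psi\<close>
  is.\<close>

lemma stage_0: "\<exists>\<sigma>. stage 0 \<sigma>"
proof -
  interpret finite_measure unit_measure by (rule finite_measure_unit_measure)
  obtain z where z: "z \<in> K" using K by blast
  obtain k where k: "\<forall>y\<in>cyl z k. norm (f y - f z) \<le> 1 / 2"
    using continuous_on_cyl[OF cont, of "1/2" z] by auto
  have "stage 0 (\<lambda>_. z, \<lambda>_. 0, k)"
    using z k order_trans[OF psi_le_1[of s 0], of 2] by (auto simp: stage_def vimage_def)
  then show ?thesis by blast
qed

text \<open>Each atom \<open>z\<close> becomes a cluster distributed like a spread inside a small
  cylinder about \<open>z\<close>. At the scale \<open>r\<close> of that spread, the cluster itself
  and all other clusters each contribute at most \<open>r powr \<beta>\<close> to the potential at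
  its atoms. This is the origin of the factor 2.\<close>

lemma stage_Suc:
  assumes "stage n (Z, R, k)"
  shows "\<exists>Z' R' k'. stage (Suc n) (Z', R', k') \<and> k \<le> k' \<and> (\<forall>\<omega>. Z' \<omega> \<in> cyl (Z \<omega>) k)"
proof -
  interpret finite_measure unit_measure by (rule finite_measure_unit_measure)
  define S where "S = range Z"
  have S: "finite S" "S \<subseteq> K" "inj_on f S" and Z: "\<And>\<omega>. Z \<omega> \<in> S" "\<And>z. Z -` {z} \<in> sets borel"
    using assms by (auto simp: stage_def S_def)
  obtain \<delta> where \<delta>: "\<delta> > 0" "\<And>x y. x \<in> S \<Longrightarrow> y \<in> S \<Longrightarrow> x \<noteq> y \<Longrightarrow> \<delta> \<le> norm (f x - f y)"
    using finite_image_separation[OF S(1,3)] by blast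
  \<comment> \<open>Moving both points by at most a quarter of the gap leaves half of it between
    clusters.\<close>
  obtain k0 where k0: "k \<le> k0" "\<And>z y. z \<in> S \<Longrightarrow> y \<in> cyl z k0 \<Longrightarrow> norm (f y - f z) \<le> \<delta> / 4"
    using continuous_on_cyl_uniform[OF cont, of "\<delta> / 4" S k] \<delta> S by auto
  have sep: "\<delta> / 2 \<le> norm (f y - f y')"
    if "z \<in> S" "z' \<in> S" "z \<noteq> z'" "y \<in> cyl z k0" "y' \<in> cyl z' k0" for z z' y y'
  proof -
    have "norm (f z - f z') \<le> norm (f z - f y) + norm (f y - f y') + norm (f y' - f z')"
      using norm_triangle_ineq[of "f z - f y" "f y - f y'"]
        norm_triangle_ineq[of "f z - f y'" "f y' - f z'"] by simp
    then show ?thesis using \<delta>(2)[of z z'] k0(2)[of z y] k0(2)[of z' y'] that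
      by (simp add: norm_minus_commute)
  qed
  \<comment> \<open>From this exponent on, atoms of other clusters, at distance at least
    \<open>\<delta> / 2\<close>, contribute at most \<open>r powr \<beta>\<close>.\<close>
  obtain n0 where n0: "\<And>m. n0 \<le> m \<Longrightarrow> ((1/2) ^ m / (\<delta> / 2)) powr s \<le> ((1/2) ^ m) powr \<beta>"
    using dyadic_powr_le_powr[OF s(2), of "\<delta> / 2"] \<delta> by auto
  \<comment> \<open>One code is chosen for each atom of the spread, so that \<open>f\<close> is
    injective within a cluster; \<open>sep\<close> provides injectivity across clusters.\<close>
  have "\<forall>z\<in>S. \<exists>m Y p. max n0 (Suc n) \<le> m \<and> Y \<subseteq> K \<inter> cyl z k0 \<and> inj_on f Y \<and> dyadic_spread s \<beta> m (f ` Y) p"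
  proof
    fix z assume "z \<in> S"
    then obtain m X p where "max n0 (Suc n) \<le> m" "X \<subseteq> f ` (K \<inter> cyl z k0)" "dyadic_spread s \<beta> m X p"
      using spread[of z "max n0 (Suc n)" k0] S by blast
    moreover then obtain Y where "Y \<subseteq> K \<inter> cyl z k0" "inj_on f Y" "X = f ` Y"
      unfolding subset_image_inj by blast
    ultimately show "\<exists>m Y p. max n0 (Suc n) \<le> m \<and> Y \<subseteq> K \<inter> cyl z k0 \<and> inj_on f Y \<and> dyadic_spread s \<beta> m (f ` Y) p"
      by blast
  qed
  then obtain m Y p where m: "\<And>z. z \<in> S \<Longrightarrow> max n0 (Suc n) \<le> m z"
    and Y: "\<And>z. z \<in> S \<Longrightarrow> Y z \<subseteq> K \<inter> cyl z k0" "\<And>z. z \<in> S \<Longrightarrow> inj_on f (Y z)"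
    and p: "\<And>z. z \<in> S \<Longrightarrow> dyadic_spread s \<beta> (m z) (f ` Y z) (p z)"
    by (metis bchoice)
  have finY: "finite (Y z)" "Y z \<noteq> {}" if "z \<in> S" for z
    using p[OF that] Y(2)[OF that] by (auto simp: dyadic_spread_def dest: finite_imageD)
  define \<mu> where "\<mu> z = measure unit_measure (Z -` {z})" for z
  have "\<forall>z\<in>S. \<exists>g. (\<forall>\<omega>\<in>Z -` {z}. g \<omega> \<in> Y z) \<and> (\<forall>y\<in>Y z. {\<omega>\<in>Z -` {z}. g \<omega> = y} \<in> sets borel \<and>
      measure unit_measure {\<omega>\<in>Z -` {z}. g \<omega> = y} = p z (f y) * \<mu> z)"
  proof (intro ballI unit_measure_partition)
    fix z assume z: "z \<in> S"
    show "(\<Sum>y\<in>Y z. p z (f y) * \<mu> z) = measure unit_measure (Z -` {z})"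
      using p[OF z] Y(2)[OF z] by (simp add: dyadic_spread_def sum.reindex \<mu>_def flip: sum_distrib_right)
    show "0 \<le> p z (f y) * \<mu> z" if "y \<in> Y z" for y
      using p[OF z] that by (auto simp: dyadic_spread_def \<mu>_def)
  qed (use finY Z in auto)
  from bchoice[OF this] obtain g where g':
    "\<forall>z\<in>S. (\<forall>\<omega>\<in>Z -` {z}. g z \<omega> \<in> Y z) \<and> (\<forall>y\<in>Y z. {\<omega>\<in>Z -` {z}. g z \<omega> = y} \<in> sets borel \<and>
      measure unit_measure {\<omega>\<in>Z -` {z}. g z \<omega> = y} = p z (f y) * \<mu> z)" ..
  have g: "\<And>z \<omega>. z \<in> S \<Longrightarrow> Z \<omega> = z \<Longrightarrow> g z \<omega> \<in> Y z"
    "\<And>z y. z \<in> S \<Longrightarrow> y \<in> Y z \<Longrightarrow> {\<omega>\<in>Z -` {z}. g z \<omega> = y} \<in> sets borel"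
    "\<And>z y. z \<in> S \<Longrightarrow> y \<in> Y z \<Longrightarrow> measure unit_measure {\<omega>\<in>Z -` {z}. g z \<omega> = y} = p z (f y) * \<mu> z"
    using g' by auto
  define Z' where "Z' \<omega> = g (Z \<omega>) \<omega>" for \<omega>
  define R' where "R' \<omega> = m (Z \<omega>)" for \<omega>
  have Z'Y: "Z' \<omega> \<in> Y (Z \<omega>)" for \<omega> using g(1)[OF Z(1) refl] by (simp add: Z'_def)
  have Z'cyl: "Z' \<omega> \<in> cyl (Z \<omega>) k0" for \<omega> using Z'Y Y(1) Z(1) by blast
  have finZ': "finite (range Z')"
    by (rule finite_subset[of _ "\<Union>z\<in>S. Y z"]) (use Z'Y Z(1) S finY in auto)
  have Z'meas: "Z' -` {y} \<in> sets borel" for y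
  proof -
    have "Z' -` {y} = (\<Union>z\<in>{z\<in>S. y \<in> Y z}. {\<omega>\<in>Z -` {z}. g z \<omega> = y})"
      using Z'Y Z(1) by (auto simp: Z'_def)
    also have "\<dots> \<in> sets borel" using S g(2) by auto
    finally show ?thesis .
  qed
  have inj: "inj_on f (range Z')"
  proof (rule inj_onI, clarify)
    fix \<omega> \<omega>' assume eq: "f (Z' \<omega>) = f (Z' \<omega>')"
    show "Z' \<omega> = Z' \<omega>'"
    proof (cases "Z \<omega> = Z \<omega>'")
      case True
      then show ?thesis using Z'Y[of \<omega>] Z'Y[of \<omega>'] Y(2)[OF Z(1)] eq by (auto dest: inj_onD)
    next
      case False
      from sep[OF Z(1) Z(1) False Z'cyl Z'cyl] eq \<delta> show ?thesis by simp
    qed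
  qed
  have energy: "(\<integral>\<omega>'. psi s ((f (Z' \<omega>) - f (Z' \<omega>')) /\<^sub>R (1/2) ^ R' \<omega>) \<partial>unit_measure) \<le> 2 * ((1/2) ^ R' \<omega>) powr \<beta>" for \<omega>
  proof -
    define z where "z = Z \<omega>"
    define r where "r = (1/2::real) ^ m z"
    define h where "h y = psi s ((f (Z' \<omega>) - f y) /\<^sub>R r)" for y
    have z: "z \<in> S" and r: "0 < r" using Z(1) by (auto simp: z_def r_def)
    have h: "0 \<le> h y" for y by (simp add: h_def psi_nonneg)
    have far: "h (Z' \<omega>') \<le> r powr \<beta>" if "Z \<omega>' \<noteq> z" for \<omega>'
    proof -
      have "h (Z' \<omega>') \<le> (r / (\<delta> / 2)) powr s"
        unfolding h_def using \<delta> sep[OF Z(1) Z(1) _ Z'cyl Z'cyl, of \<omega> \<omega>'] that s r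
        by (intro psi_divideR_le) (auto simp: z_def)
      also have "\<dots> \<le> r powr \<beta>" unfolding r_def using m[OF z] by (intro n0) simp
      finally show ?thesis .
    qed
    \<comment> \<open>The kernel on the own cluster as a simple function, vanishing on all other
      clusters.\<close>
    let ?I = "\<lambda>\<omega>'. \<Sum>y\<in>Y z. h y * indicator {\<omega>\<in>Z -` {z}. g z \<omega> = y} \<omega>'"
    have I: "?I \<omega>' = h (Z' \<omega>')" if "Z \<omega>' = z" for \<omega>'
    proof -
      have "?I \<omega>' = (\<Sum>y\<in>Y z. if y = Z' \<omega>' then h y else 0)"
        using that by (intro sum.cong) (auto simp: Z'_def indicator_def)
      also have "\<dots> = h (Z' \<omega>')" using finY z Z'Y[of \<omega>'] that by (simp add: sum.delta)
      finally show ?thesis .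
    qed
    have int: "integrable unit_measure (\<lambda>\<omega>'. h y * indicator {\<omega>\<in>Z -` {z}. g z \<omega> = y} \<omega>')" if "y \<in> Y z" for y
      using g(2)[OF z that] by (intro integrable_mult_right integrable_real_indicator) (auto simp: less_top[symmetric])
    have "(\<integral>\<omega>'. psi s ((f (Z' \<omega>) - f (Z' \<omega>')) /\<^sub>R (1/2) ^ R' \<omega>) \<partial>unit_measure) = (\<integral>\<omega>'. h (Z' \<omega>') \<partial>unit_measure)"
      by (simp add: h_def r_def R'_def z_def)
    also have "\<dots> \<le> (\<integral>\<omega>'. r powr \<beta> + ?I \<omega>' \<partial>unit_measure)"
    proof (intro integral_mono Bochner_Integration.integrable_add Bochner_Integration.integrable_sum int)
      show "integrable unit_measure (\<lambda>\<omega>'. h (Z' \<omega>'))"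
        using measurable_finite_range[OF finZ' Z'meas, of h] psi_le_1 h
        by (intro integrable_const_bound[where B=1]) (auto simp: h_def)
      show "h (Z' \<omega>') \<le> r powr \<beta> + ?I \<omega>'" for \<omega>'
        using I[of \<omega>'] far[of \<omega>'] h by (cases "Z \<omega>' = z") (auto intro!: add_increasing2 sum_nonneg)
    qed auto
    also have "\<dots> = r powr \<beta> + (\<Sum>y\<in>Y z. h y * (p z (f y) * \<mu> z))"
      using int g(2,3)[OF z] by (subst Bochner_Integration.integral_add)
        (auto intro!: Bochner_Integration.integrable_sum simp: Bochner_Integration.integral_sum)
    also have "(\<Sum>y\<in>Y z. h y * (p z (f y) * \<mu> z)) = \<mu> z * (\<Sum>y\<in>Y z. p z (f y) * h y)"
      by (simp add: sum_distrib_left mult_ac)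
    also have "(\<Sum>y\<in>Y z. p z (f y) * h y) = (\<Sum>x\<in>f ` Y z. p z x * psi s ((f (Z' \<omega>) - x) /\<^sub>R r))"
      using Y(2)[OF z] by (simp add: sum.reindex h_def)
    also have "\<mu> z * \<dots> \<le> 1 * r powr \<beta>"
    proof (intro mult_mono)
      show "\<mu> z \<le> 1" using bounded_measure[of "Z -` {z}"] by (simp add: \<mu>_def)
      show "(\<Sum>x\<in>f ` Y z. p z x * psi s ((f (Z' \<omega>) - x) /\<^sub>R r)) \<le> r powr \<beta>"
        using p[OF z] Z'Y[of \<omega>] unfolding dyadic_spread_def r_def z_def by blast
      show "0 \<le> (\<Sum>x\<in>f ` Y z. p z x * psi s ((f (Z' \<omega>) - x) /\<^sub>R r))"
        using p[OF z] unfolding dyadic_spread_def by (intro sum_nonneg mult_nonneg_nonneg psi_nonneg) auto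
    qed auto
    finally show ?thesis by (simp add: r_def R'_def z_def)
  qed
  have R'S: "R' \<omega> \<in> m ` S" for \<omega> using Z(1) by (auto simp: R'_def)
  obtain k' where k': "max k (Suc n) \<le> k'"
    "\<And>z y. z \<in> range Z' \<Longrightarrow> y \<in> cyl z k' \<Longrightarrow> norm (f y - f z) \<le> (1/2) ^ Max (m ` S) / 2"
    using continuous_on_cyl_uniform[OF cont, of "(1/2) ^ Max (m ` S) / 2" "range Z'" "max k (Suc n)"] finZ' by auto
  have near: "norm (f y - f (Z' \<omega>')) \<le> (1/2) ^ R' \<omega> / 2" if "y \<in> cyl (Z' \<omega>') k'" for \<omega> \<omega>' y
  proof -
    have "(1/2::real) ^ Max (m ` S) \<le> (1/2) ^ R' \<omega>"
      using R'S S(1) by (intro power_decreasing Max_ge) auto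
    moreover have "norm (f y - f (Z' \<omega>')) \<le> (1/2) ^ Max (m ` S) / 2" using that by (intro k'(2)) auto
    ultimately show ?thesis by linarith
  qed
  have "stage (Suc n) (Z', R', k')"
    unfolding stage_def using finZ' Z'meas inj energy near k'(1) Z'Y Y(1) Z(1) m
    by (fastforce simp: R'_def)
  moreover have "Z' \<omega> \<in> cyl (Z \<omega>) k" for \<omega>
    using Z'cyl cyl_antimono[OF k0(1)] by blast
  ultimately show ?thesis using k'(1) by auto
qed

text \<open>The measure is the law of the limit \<open>X\<close> of the stages. At each scale chosen
  by stage \<open>n\<close>, replacing that stage by \<open>X\<close> changes the potential at most
  by the factor \<open>2 powr s\<close>.\<close>

lemma exists_spread_measure:
  "\<exists>\<mu>\<in>Mc_plus (range f). AE x in \<mu>. \<forall>n. \<exists>m\<ge>n.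
     FH_kernel s \<mu> x ((1/2) ^ m) \<le> 2 powr s * (2 * ((1/2) ^ m) powr \<beta>)"
proof -
  interpret U: finite_measure unit_measure by (rule finite_measure_unit_measure)
  let ?Q = "\<lambda>(n::nat) (Z, R :: real \<Rightarrow> nat, k) (Z', R' :: real \<Rightarrow> nat, k'). k \<le> k' \<and> (\<forall>\<omega>::real. Z' \<omega> \<in> cyl (Z \<omega>) k)"
  have "\<exists>\<sigma>. \<forall>n. stage n (\<sigma> n) \<and> ?Q n (\<sigma> n) (\<sigma> (Suc n))"
  proof (rule dependent_nat_choice)
    show "\<exists>\<sigma>. stage 0 \<sigma>" by (rule stage_0)
    show "\<exists>\<tau>. stage (Suc n) \<tau> \<and> ?Q n \<sigma> \<tau>" if "stage n \<sigma>" for \<sigma> n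
      using stage_Suc that by (cases \<sigma>) fastforce
  qed
  then obtain \<sigma> where \<sigma>': "\<forall>n. stage n (\<sigma> n) \<and> ?Q n (\<sigma> n) (\<sigma> (Suc n))" ..
  then have \<sigma>: "stage n (\<sigma> n)" "?Q n (\<sigma> n) (\<sigma> (Suc n))" for n by simp_all
  define Z where "Z n = fst (\<sigma> n)" for n
  define R where "R n = fst (snd (\<sigma> n))" for n
  define k where "k n = snd (snd (\<sigma> n))" for n
  have \<sigma>_eq: "\<sigma> n = (Z n, R n, k n)" for n by (simp add: Z_def R_def k_def)
  have finZ: "finite (range (Z n))" and Zmeas: "Z n -` {z} \<in> sets borel"
    and kn: "n \<le> k n" and Rn: "n \<le> R n \<omega>"
    and energy: "(\<integral>\<omega>'. psi s ((f (Z n \<omega>) - f (Z n \<omega>')) /\<^sub>R (1/2) ^ R n \<omega>) \<partial>unit_measure)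
      \<le> 2 * ((1/2) ^ R n \<omega>) powr \<beta>"
    and near: "y \<in> cyl (Z n \<omega>') (k n) \<Longrightarrow> norm (f y - f (Z n \<omega>')) \<le> (1/2) ^ R n \<omega> / 2" for n z \<omega> \<omega>' y
    using \<sigma>(1)[of n] unfolding \<sigma>_eq stage_def by auto
  have succ: "k n \<le> k (Suc n)" "Z (Suc n) \<omega> \<in> cyl (Z n \<omega>) (k n)" for n \<omega>
    using \<sigma>(2)[of n] unfolding \<sigma>_eq by auto
  have k_mono: "k n \<le> k l" if "n \<le> l" for n l by (rule lift_Suc_mono_le[of k, OF succ(1) that])
  have Z_cyl: "Z l \<omega> \<in> cyl (Z n \<omega>) (k n)" if "n \<le> l" for n l \<omega>
    using that
  proof (induction rule: dec_induct)
    case base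
    show ?case by (rule cyl_self)
  next
    case (step l)
    show ?case using cyl_trans[OF succ(2) step.IH k_mono[OF step.hyps(1)]] .
  qed
  \<comment> \<open>A diagonal choice: since \<open>j < k (Suc j)\<close>, coordinate
    \<open>j\<close> no longer changes after stage \<open>Suc j\<close>.\<close>
  define z where "z \<omega> j = Z (Suc j) \<omega> j" for \<omega> j
  have z_cyl: "z \<omega> \<in> cyl (Z n \<omega>) (k n)" for \<omega> n
    unfolding cyl_def
  proof (intro CollectI allI impI)
    fix j assume j: "j < k n"
    have "j < k (Suc j)" using kn[of "Suc j"] by simp
    with j Z_cyl[of n "Suc j" \<omega>] Z_cyl[of "Suc j" n \<omega>] show "z \<omega> j = Z n \<omega> j"
      by (cases "n \<le> Suc j") (auto simp: cyl_def z_def)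
  qed
  define X where "X \<omega> = f (z \<omega>)" for \<omega>
  have X_near: "norm (X \<omega>' - f (Z n \<omega>')) \<le> (1/2) ^ R n \<omega> / 2" for n \<omega> \<omega>'
    unfolding X_def by (rule near[OF z_cyl])
  have fZ_meas [measurable]: "(\<lambda>\<omega>. f (Z n \<omega>)) \<in> borel_measurable borel" for n
    by (rule measurable_finite_range[OF finZ Zmeas])
  have [measurable]: "X \<in> borel_measurable borel"
  proof (rule borel_measurable_LIMSEQ_metric[OF fZ_meas])
    fix \<omega>
    have "norm (f (Z n \<omega>) - X \<omega>) \<le> (1/2) ^ n" for n
    proof -
      have "(1/2::real) ^ R n \<omega> \<le> (1/2) ^ n" using Rn by (intro power_decreasing) auto
      with X_near[of \<omega> n \<omega>] show ?thesis
        using norm_ge_zero[of "X \<omega> - f (Z n \<omega>)"] unfolding norm_minus_commute[of "f (Z n \<omega>)"] by linarith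
    qed
    then have "(\<lambda>n. f (Z n \<omega>) - X \<omega>) \<longlonglongrightarrow> 0"
      by (intro Lim_null_comparison[OF always_eventually LIMSEQ_realpow_zero[of "1/2"]]) auto
    then show "(\<lambda>n. f (Z n \<omega>)) \<longlonglongrightarrow> X \<omega>" by (simp add: LIM_zero_iff)
  qed
  define \<mu> where "\<mu> = distr unit_measure borel X"
  have fin: "finite_measure \<mu>" unfolding \<mu>_def by (intro U.finite_measure_distr) simp
  have sets_\<mu> [measurable_cong]: "sets \<mu> = sets borel" by (simp add: \<mu>_def)
  have FH: "FH_kernel s \<mu> x r = (\<integral>\<omega>. psi s ((x - X \<omega>) /\<^sub>R r) \<partial>unit_measure)" for x r
    unfolding FH_kernel_def \<mu>_def
    by (rule integral_distr) (auto intro!: borel_measurable_psi s(1))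
  \<comment> \<open>Both arguments of the kernel move by at most half the scale, so their difference
    moves by at most \<open>?r\<close>.\<close>
  have FH_le: "FH_kernel s \<mu> (X \<omega>) ((1/2) ^ R n \<omega>) \<le> 2 powr s * (2 * ((1/2) ^ R n \<omega>) powr \<beta>)" for n \<omega>
  proof -
    let ?r = "(1/2::real) ^ R n \<omega>"
    have "FH_kernel s \<mu> (X \<omega>) ?r \<le> (\<integral>\<omega>'. 2 powr s * psi s ((f (Z n \<omega>) - f (Z n \<omega>')) /\<^sub>R ?r) \<partial>unit_measure)"
      unfolding FH
    proof (intro integral_mono integrable_mult_right integrable_psi s(1) finite_measure_unit_measure)
      fix \<omega>'
      have "norm ((X \<omega> - X \<omega>') - (f (Z n \<omega>) - f (Z n \<omega>'))) \<le> norm (X \<omega> - f (Z n \<omega>)) + norm (X \<omega>' - f (Z n \<omega>'))"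
        using norm_triangle_ineq4[of "X \<omega> - f (Z n \<omega>)" "X \<omega>' - f (Z n \<omega>')"] by (simp add: algebra_simps)
      also have "\<dots> \<le> ?r" using X_near[of \<omega> n \<omega>] X_near[of \<omega>' n \<omega>] by simp
      finally show "psi s ((X \<omega> - X \<omega>') /\<^sub>R ?r) \<le> 2 powr s * psi s ((f (Z n \<omega>) - f (Z n \<omega>')) /\<^sub>R ?r)"
        by (intro psi_divideR_perturb s(1)) auto
    qed auto
    also have "\<dots> \<le> 2 powr s * (2 * ?r powr \<beta>)"
      using energy[of n \<omega>] by (simp del: power_one_over)
    finally show ?thesis .
  qed
  have "AE x in \<mu>. \<forall>n. \<exists>m\<ge>n. FH_kernel s \<mu> x ((1/2) ^ m) \<le> 2 powr s * (2 * ((1/2) ^ m) powr \<beta>)"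
  proof -
    have [measurable]: "(\<lambda>x. FH_kernel s \<mu> x r) \<in> borel_measurable borel" for r
    proof -
      interpret finite_measure \<mu> by (rule fin)
      have "(\<lambda>x. \<integral>y. psi s ((x - y) /\<^sub>R r) \<partial>\<mu>) \<in> borel_measurable borel"
        using borel_measurable_psi[OF s(1), of "\<lambda>(x, y). (x - y) /\<^sub>R r" "borel \<Otimes>\<^sub>M \<mu>"]
        by (intro borel_measurable_lebesgue_integral) (auto simp: split_beta')
      then show ?thesis by (simp add: FH_kernel_def)
    qed
    show ?thesis
      unfolding \<mu>_def[symmetric]
      by (subst \<mu>_def, subst AE_distr_iff) (auto intro!: AE_I2 intro: FH_le Rn)
  qed
  moreover have "\<mu> \<in> Mc_plus (range f)"
  proof -
    \<comment> \<open>Each coordinate takes finitely many values, so \<open>C\<close> is compact. It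
      need not lie in \<open>K\<close>, but its image lies in \<open>range f\<close>, as the support
      must.\<close>
    define C where "C = {y. \<forall>j. y j \<in> range (\<lambda>\<omega>. z \<omega> j)}"
    have "finite (range (\<lambda>\<omega>. z \<omega> j))" for j
    proof -
      have "range (\<lambda>\<omega>. z \<omega> j) = (\<lambda>y. y j) ` range (Z (Suc j))" by (auto simp: z_def)
      then show ?thesis using finZ by simp
    qed
    then have "compact C" unfolding C_def by (rule compact_finitely_branching)
    then have comp: "compact (f ` C)" using cont by (intro compact_continuous_image) (auto intro: continuous_on_subset)
    have XC: "X \<omega> \<in> f ` C" for \<omega> by (auto simp: X_def C_def)
    have supp: "measure_support \<mu> \<subseteq> f ` C"
    proof
      fix x assume x: "x \<in> measure_support \<mu>"
      show "x \<in> f ` C"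
      proof (rule ccontr)
        assume "x \<notin> f ` C"
        moreover have "open (- (f ` C))" using comp by (simp add: compact_imp_closed open_Compl)
        ultimately have "emeasure \<mu> (- (f ` C)) > 0" using x by (auto simp: measure_support_def)
        moreover have "X -` (- (f ` C)) \<inter> space unit_measure = {}" using XC by auto
        ultimately show False
          using \<open>open (- (f ` C))\<close> by (simp add: \<mu>_def emeasure_distr)
      qed
    qed
    have "closed (measure_support \<mu>)"
    proof -
      have "- measure_support \<mu> = \<Union>{U. open U \<and> \<not> emeasure \<mu> U > 0}"
        by (auto simp: measure_support_def)
      then have "open (- measure_support \<mu>)" by auto
      then show ?thesis by (simp add: closed_def)
    qed
    then have "compact (measure_support \<mu>)"
      using comp supp by (metis compact_Int_closed inf.absorb2)
    moreover have "emeasure \<mu> (space \<mu>) \<noteq> 0"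
      by (simp add: \<mu>_def emeasure_distr U.emeasure_eq_measure)
    ultimately show ?thesis
      using supp fin sets_\<mu> by (auto simp: Mc_plus_def finite_borel_measure_def)
  qed
  ultimately show ?thesis by blast
qed

end

section \<open>From the limit measure to the inequality of dimensions\<close>

lemma Liminf_eq_0_dyadic:
  fixes F :: "real \<Rightarrow> real"
  assumes "t < \<beta>" and F: "\<And>n. \<exists>m\<ge>n. F ((1/2) ^ m) \<le> c * ((1/2) ^ m) powr \<beta>"
  shows "Liminf (at_right 0) (\<lambda>r. ennreal (F r / r powr t)) = 0"
proof (rule ccontr)
  assume "\<not> ?thesis"
  then obtain e' where e': "0 < e'" "e' < Liminf (at_right 0) (\<lambda>r. ennreal (F r / r powr t))"
    using dense[of "0::ennreal"] by (auto simp: zero_less_iff_neq_zero)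
  then obtain e where e: "e > 0" "e' = ennreal e"
    by (cases e') (auto simp: ennreal_less_zero_iff)
  have "\<forall>\<^sub>F r in at_right 0. ennreal e < ennreal (F r / r powr t)"
    using less_LiminfD[OF e'(2)] by (simp add: e)
  then obtain d where d: "0 < d" "\<And>r. 0 < r \<Longrightarrow> r < d \<Longrightarrow> ennreal e < ennreal (F r / r powr t)"
    by (auto simp: eventually_at_right_field)
  define q where "q = (1/2::real) powr (\<beta> - t)"
  have q: "0 < q" "q < 1" using assms(1) by (auto simp: q_def powr01_less_one)
  obtain n1 where n1: "(1/2::real) ^ n1 < d" using real_arch_pow_inv[OF d(1), of "1/2"] by auto
  \<comment> \<open>Along the given scales the quotient is at most \<open>c * q ^ m\<close>; the
    positive constant \<open>\<bar>c\<bar> + 1\<close> bounds \<open>c\<close> whatever its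
    sign.\<close>
  obtain n2 where n2: "q ^ n2 < e / (\<bar>c\<bar> + 1)" using real_arch_pow_inv[of "e / (\<bar>c\<bar> + 1)" q] q e by auto
  obtain m where m: "m \<ge> max n1 n2" "F ((1/2) ^ m) \<le> c * ((1/2) ^ m) powr \<beta>" using F by blast
  define r where "r = (1/2::real) ^ m"
  have r: "0 < r" "r < d"
    using n1 power_decreasing[of n1 m "1/2::real"] m(1) by (auto simp: r_def simp del: power_decreasing_iff)
  have "F r / r powr t \<le> c * r powr \<beta> / r powr t"
    using m(2) r by (intro divide_right_mono) (auto simp: r_def)
  also have "\<dots> = c * r powr (\<beta> - t)" by (simp add: powr_diff)
  also have "r powr (\<beta> - t) = q ^ m"
    by (simp add: r_def q_def powr_power powr_powr mult_ac flip: powr_realpow)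
  also have "c * q ^ m \<le> (\<bar>c\<bar> + 1) * q ^ n2"
    using q m(1) by (intro mult_mono power_decreasing) auto
  also have "\<dots> < e" using n2 by (simp add: field_simps)
  finally have "F r / r powr t < e" .
  moreover have "e < F r / r powr t" using d(2)[OF r] e by (simp add: ennreal_less_iff)
  ultimately show False by simp
qed

lemma P_dim_le_Dim:
  fixes E :: "'a::euclidean_space set"
  assumes s: "0 \<le> s" and E: "analytic_set E"
  shows "P_dim s E \<le> Dim s E"
proof (rule ccontr)
  assume "\<not> ?thesis"
  then have "Dim s E < P_dim s E" by simp
  \<comment> \<open>Three numbers are inserted in the gap: \<open>t\<close> for the liminf,
    \<open>\<beta>\<close> for the spreads and \<open>\<alpha>\<close> for the packing measure. Each
    strict inequality yields a geometric factor.\<close>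
  from dense[OF this] obtain a where a: "Dim s E < a" "a < P_dim s E" by blast
  from dense[OF a(2)] obtain b where b: "a < b" "b < P_dim s E" by blast
  from dense[OF b(2)] obtain c where c: "b < c" "c < P_dim s E" by blast
  obtain t \<beta> \<alpha> where abc: "a = ennreal t" "0 \<le> t" "b = ennreal \<beta>" "0 \<le> \<beta>" "c = ennreal \<alpha>" "0 \<le> \<alpha>"
    using a b c by (cases a; cases b; cases c) auto
  then have less: "t < \<beta>" "\<beta> < \<alpha>" using b c by (auto simp: ennreal_less_iff)
  have "packing_measure \<alpha> s E \<noteq> 0"
  proof
    assume "packing_measure \<alpha> s E = 0"
    then have "P_dim s E \<le> c" unfolding P_dim_def abc using less abc by (intro INF_lower) auto
    then show False using c by simp
  qed
  then have thin: "\<not> packing_thin \<alpha> s E" using packing_thin_imp_packing_measure_0 by blast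
  then have "E \<noteq> {}" using packing_thinI[OF packing_premeasure_empty] by blast
  then obtain f :: "(nat \<Rightarrow> nat) \<Rightarrow> 'a" where f: "continuous_on UNIV f" "E = range f"
    using E by (auto simp: analytic_set_def)
  obtain K where K: "K \<noteq> {}" "\<And>z k. z \<in> K \<Longrightarrow> \<not> packing_thin \<alpha> s (f ` (K \<inter> cyl z k))"
    using not_packing_thin_kernel[of \<alpha> s f] thin f by blast
  then have pos: "packing_premeasure \<alpha> s (f ` (K \<inter> cyl z k)) \<noteq> 0" if "z \<in> K" for z k
    using that packing_thinI by blast
  \<comment> \<open>Continuity bounds the image of some cylinder of positive premeasure. The result
    gives \<open>\<beta> < s\<close>, as the tree construction requires.\<close>
  have "\<alpha> \<le> s"
  proof -
    obtain z where z: "z \<in> K" using K by blast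
    obtain k where k: "\<forall>y\<in>cyl z k. norm (f y - f z) \<le> 1"
      using continuous_on_cyl[OF f(1), of 1] by auto
    have "bounded (f ` (K \<inter> cyl z k))"
      by (rule bounded_subset[OF bounded_cball[of "f z" 1]]) (use k in \<open>auto simp: dist_norm norm_minus_commute\<close>)
    then show ?thesis using packing_premeasure_bounded_pos_imp_le[OF s abc(6) pos[OF z]] by blast
  qed
  interpret spread_tree f K s \<beta>
  proof
    show "\<exists>m\<ge>n. \<exists>Y p. Y \<subseteq> f ` (K \<inter> cyl z k) \<and> dyadic_spread s \<beta> m Y p" if "z \<in> K" for z n k
      using packing_premeasure_pos_imp_dyadic_spread[OF s abc(6) less(2) pos[OF that]] by blast
  qed (use s less \<open>\<alpha> \<le> s\<close> f K in auto)
  obtain \<mu> where \<mu>: "\<mu> \<in> Mc_plus E" and AE: "AE x in \<mu>. \<forall>n. \<exists>m\<ge>n.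
     FH_kernel s \<mu> x ((1/2) ^ m) \<le> 2 powr s * (2 * ((1/2) ^ m) powr \<beta>)"
    using exists_spread_measure f(2) by blast
  have "AE x in \<mu>. Liminf (at_right 0) (\<lambda>r. ennreal (FH_kernel s \<mu> x r / r powr t)) = 0"
    using AE
  proof eventually_elim
    case (elim x)
    then show ?case
      by (intro Liminf_eq_0_dyadic[OF less(1), of "FH_kernel s \<mu> x" "2 powr s * 2"]) (simp add: mult.assoc)
  qed
  then have "ennreal t \<le> Dim_measure s \<mu>"
    unfolding Dim_measure_def using abc by (intro SUP_upper) auto
  also have "\<dots> \<le> Dim s E" unfolding Dim_def using \<mu> by (rule SUP_upper)
  finally show False using a abc by simp
qed

theorem theorem1p1:
  fixes E :: "(real ^ 'n) set" and s :: real
  assumes "s > 0" and "analytic_set E"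
  shows "P_dim s E = Dim s E"
  using assms by (intro antisym P_dim_le_Dim Dim_le_P_dim) auto

end
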